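(* Fix $s\in(0,\infty)$ and $m,n\in\mathbb{N}$. Let $a:(0,\infty)\rightarrow\mathbb{C}$ be a function and, for each $t\in(0,\infty)$, consider the Toeplitz operator $T_{\varphi}$ on $A^2(\mathbb{D})$ with symbol \[ \varphi(z)=z^{n}|z|^{2s}+a(t)\bar{z}^{m}|z|^{2t}. \] (i) If \[ \limsup_{t\rightarrow\infty}|t\,a(t)|<\frac{n+2s}{2}, \] then for all sufficiently large $t$, the operator $T_{\varphi}$ is hyponormal. (ii) If \[ \liminf_{t\rightarrow\infty}|t\,a(t)|>\frac{n+2s}{2}, \] then for all sufficiently large $t$, the operator $T_{\varphi}$ is not hyponormal.
   Context: $\mathbb{N}$ denotes the positive integers. $\mathbb{D}$ is the open unit disk in $\mathbb{C}$ and $dA$ is normalized area measure on $\mathbb{D}$. The Bergman space $A^2(\mathbb{D})$ is the Hilbert space of analytic functions $f$ on $\mathbb{D}$ with $\int_{\mathbb{D}}|f|^2\,dA<\infty$, with inner product $\langle f,g\rangle=\int_{\mathbb{D}}f\bar{g}\,dA$. For $\varphi\in L^{\infty}(\mathbb{D})$, the Toeplitz operator $T_{\varphi}:A^2(\mathbb{D})\rightarrow A^2(\mathbb{D})$ is defined by $T_{\varphi}(f)=P(\varphi f)$, where $P:L^2(\mathbb{D},dA)\rightarrow A^2(\mathbb{D})$ is the orthogonal projection. A bounded operator $T$ on a Hilbert space is hyponormal if $[T^*,T]=T^*T-TT^*\geq0$. *)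

theory Defs
  imports "HOL-Complex_Analysis.Complex_Analysis"
begin

abbreviation unit_disk :: "complex set"
  where "unit_disk \<equiv> ball 0 1"

definition disk_area :: "complex measure"
  where "disk_area = density (lebesgue_on unit_disk) (\<lambda>_. ennreal (1 / pi))"

definition L2_inner :: "(complex \<Rightarrow> complex) \<Rightarrow> (complex \<Rightarrow> complex) \<Rightarrow> complex"
  where "L2_inner f g = (LINT z|disk_area. f z * cnj (g z))"

definition L2_norm :: "(complex \<Rightarrow> complex) \<Rightarrow> real"
  where "L2_norm f = sqrt (LINT z|disk_area. (cmod (f z))\<^sup>2)"

text \<open>
  Functions on the disk are total functions on the complex plane. The elements of the Bergman
  space are normalised to vanish off the disk, so that each analytic function on the disk has
  exactly one representative; the unique choices below depend on this.
\<close>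

definition bergman_space :: "(complex \<Rightarrow> complex) set"
  where "bergman_space = {f. f holomorphic_on unit_disk \<and> (\<forall>z. z \<notin> unit_disk \<longrightarrow> f z = 0) \<and>
           integrable disk_area (\<lambda>z. (cmod (f z))\<^sup>2)}"

text \<open>
  The value of the orthogonal projection at \<open>h\<close> is the element \<open>g\<close> of the Bergman space for which
  \<open>h - g\<close> is orthogonal to that space. It is meaningful only for square-integrable \<open>h\<close>.
\<close>

definition bergman_projection :: "(complex \<Rightarrow> complex) \<Rightarrow> (complex \<Rightarrow> complex)"
  where "bergman_projection h =
    (THE g. g \<in> bergman_space \<and> (\<forall>k\<in>bergman_space. L2_inner (\<lambda>z. h z - g z) k = 0))"

definition toeplitz :: "(complex \<Rightarrow> complex) \<Rightarrow> (complex \<Rightarrow> complex) \<Rightarrow> (complex \<Rightarrow> complex)"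
  where "toeplitz \<phi> f = bergman_projection (\<lambda>z. \<phi> z * f z)"

text \<open>
  Operators on the Bergman space are maps on functions of which only the restriction to
  \<^const>\<open>bergman_space\<close> matters.
\<close>

definition bounded_operator :: "((complex \<Rightarrow> complex) \<Rightarrow> (complex \<Rightarrow> complex)) \<Rightarrow> bool"
  where "bounded_operator T \<longleftrightarrow>
    (\<forall>f\<in>bergman_space. T f \<in> bergman_space) \<and>
    (\<forall>f\<in>bergman_space. \<forall>g\<in>bergman_space. T (\<lambda>z. f z + g z) = (\<lambda>z. T f z + T g z)) \<and>
    (\<forall>c. \<forall>f\<in>bergman_space. T (\<lambda>z. c * f z) = (\<lambda>z. c * T f z)) \<and>
    (\<exists>C. \<forall>f\<in>bergman_space. L2_norm (T f) \<le> C * L2_norm f)"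

definition adjoint_operator ::
    "((complex \<Rightarrow> complex) \<Rightarrow> (complex \<Rightarrow> complex)) \<Rightarrow> (complex \<Rightarrow> complex) \<Rightarrow> (complex \<Rightarrow> complex)"
  where "adjoint_operator T g =
    (THE h. h \<in> bergman_space \<and> (\<forall>f\<in>bergman_space. L2_inner (T f) g = L2_inner f h))"

definition self_commutator ::
    "((complex \<Rightarrow> complex) \<Rightarrow> (complex \<Rightarrow> complex)) \<Rightarrow> (complex \<Rightarrow> complex) \<Rightarrow> (complex \<Rightarrow> complex)"
  where "self_commutator T f = (\<lambda>z. adjoint_operator T (T f) z - T (adjoint_operator T f) z)"

definition hyponormal :: "((complex \<Rightarrow> complex) \<Rightarrow> (complex \<Rightarrow> complex)) \<Rightarrow> bool"
  where "hyponormal T \<longleftrightarrow> bounded_operator T \<and>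
    (\<forall>f\<in>bergman_space. L2_inner (self_commutator T f) f \<in> \<real>\<^sub>\<ge>\<^sub>0)"

end

theory Submission
  imports Defs "HOL-Probability.Distribution_Functions" "HOL-Real_Asymp.Real_Asymp"
begin

text \<open>
  In the coordinates given by power series, the self-commutator of the operator in question is an
  explicit infinite matrix, and the theorem is a comparison of the decay of its entries.

  An \<open>f\<close> in the Bergman space is determined by its coefficients \<open>x\<^sub>k\<close>, with
  \<open>\<parallel>f\<parallel>\<^sup>2 = \<Sum>\<^sub>k |x\<^sub>k|\<^sup>2/(k+1)\<close>. A symbol \<open>z\<^sup>n|z|\<^bsup>2s\<^esup>\<close> acts on the
  coefficients as a weighted shift upwards by \<open>n\<close>, and its conjugate as a weighted shift downwards.
  The adjoint of \<open>T\<^sub>\<phi>\<close> has the conjugate symbol, so hyponormality says that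
  \<open>\<parallel>T\<^sub>\<phi> f\<parallel>\<^sup>2 - \<parallel>T\<^sub>\<phi>\<^sup>* f\<parallel>\<^sup>2 \<ge> 0\<close> for all \<open>f\<close>. With \<open>N = n + m\<close> this difference is
  \<open>\<Sum>\<^sub>i (\<lambda>\<^sub>i - |a|\<^sup>2 \<mu>\<^sub>i) |x\<^sub>i|\<^sup>2 + \<Sum>\<^sub>i \<nu>\<^sub>i 2 Re (x\<^sub>i cnj (a x\<^bsub>i+N\<^esub>))\<close>
  (\<open>commutator_form\<close> and \<open>hyponormal_iff_commutator_form\<close>), where \<open>\<lambda>\<close> and \<open>\<mu>\<close> come from the
  self-commutators of the two summands and \<open>\<nu>\<close> from their mixed commutator. For fixed \<open>t\<close> and
  \<open>i \<rightarrow> \<infinity>\<close> one finds \<open>i\<^sup>3 \<lambda>\<^sub>i \<rightarrow> n (n + 2 s)\<close> and \<open>i\<^sup>3 \<nu>\<^sub>i \<rightarrow> n t - m s\<close>. Thus, up to the factor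
  \<open>i\<^sup>-\<^sup>3\<close>, far out along the progression \<open>i, i + N, i + 2 N, \<dots>\<close> the form looks like a
  tridiagonal Toeplitz matrix with diagonal \<open>n (n + 2 s)\<close>, diminished by a multiple of \<open>|a|\<^sup>2\<close>,
  and off-diagonal entries of modulus \<open>|a| (n t - m s) \<approx> n |t a|\<close>. Such a matrix can be
  nonnegative only if twice the off-diagonal modulus does not exceed the diagonal, which is where
  the threshold \<open>|t a| = (n + 2 s)/2\<close> comes from.

  Below the threshold the form is nonnegative by diagonal dominance, once the asymptotic comparison
  has been made uniform in \<open>i\<close>: for large \<open>i\<close> by explicit bounds in which \<open>t\<close> enters only through
  \<open>1/t\<close>, and for each of the finitely many remaining \<open>i\<close> because everything except
  \<open>\<lambda>\<^sub>i > 0\<close> tends to \<open>0\<close> as \<open>t \<rightarrow> \<infinity>\<close> (\<open>diagonal_dominates_cross\<close>). Above the threshold a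
  long block of unimodular coefficients, supported far out on one progression and with aligned
  phases, makes the form negative (\<open>commutator_form_negative\<close>); this function is a polynomial.

  The analytic input is a single moment formula: for a bounded radial weight \<open>w\<close> and a power
  series \<open>f\<close>, the integral of \<open>w f cnj (z\<^sup>k)\<close> is the \<open>k\<close>-th coefficient times the integral of
  \<open>w |z|\<^bsup>2k\<^esup>\<close> (\<open>integral_radial_power_series\<close>). It rests on the rotation invariance of
  the area measure and on the fact that \<open>|z|\<^sup>2\<close> is uniformly distributed on the unit interval.
\<close>

section \<open>Normalized area measure on the disk\<close>

lemma distr_Complex_lborel:
  "distr lborel lborel (\<lambda>(x, y). Complex x y) = (lborel :: complex measure)"
proof (rule lborel_eqI[symmetric])
  have meas: "(\<lambda>(x, y). Complex x y) \<in> measurable (lborel :: (real \<times> real) measure) lborel"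
    unfolding case_prod_beta measurable_lborel1 measurable_lborel2
    by (intro borel_measurable_continuous_onI) (auto simp: Complex_eq intro!: continuous_intros)
  fix l u :: complex
  assume lu: "\<And>b. b \<in> Basis \<Longrightarrow> l \<bullet> b \<le> u \<bullet> b"
  have le: "Re l \<le> Re u" "Im l \<le> Im u"
    using lu[of 1] lu[of \<i>] by (auto simp: Basis_complex_def)
  have "(\<lambda>(x, y). Complex x y) -` box l u = {Re l<..<Re u} \<times> {Im l<..<Im u}"
    by (auto simp: box_def Basis_complex_def)
  then have "emeasure (distr lborel lborel (\<lambda>(x, y). Complex x y)) (box l u)
      = emeasure (lborel \<Otimes>\<^sub>M lborel) ({Re l<..<Re u} \<times> {Im l<..<Im u})"
    using meas by (subst emeasure_distr) (auto simp: lborel_prod)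
  also have "\<dots> = ennreal (Re u - Re l) * ennreal (Im u - Im l)"
    using le by (subst lborel.emeasure_pair_measure_Times) auto
  finally show "emeasure (distr lborel lborel (\<lambda>(x, y). Complex x y)) (box l u)
      = ennreal (\<Prod>b\<in>Basis. (u - l) \<bullet> b)"
    using le by (simp add: Basis_complex_def ennreal_mult)
qed simp

lemma nn_integral_complex:
  assumes [measurable]: "f \<in> borel_measurable borel"
  shows "(\<integral>\<^sup>+z. f z \<partial>lborel) = (\<integral>\<^sup>+x. (\<integral>\<^sup>+y. f (Complex x y) \<partial>lborel) \<partial>lborel)"
    and "(\<integral>\<^sup>+z. f z \<partial>lborel) = (\<integral>\<^sup>+y. (\<integral>\<^sup>+x. f (Complex x y) \<partial>lborel) \<partial>lborel)"
proof -
  have C: "(\<lambda>(x, y). Complex x y) \<in> measurable (borel :: (real \<times> real) measure) borel"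
    unfolding case_prod_beta
    by (intro borel_measurable_continuous_onI) (auto simp: Complex_eq intro!: continuous_intros)
  have "(\<integral>\<^sup>+z. f z \<partial>lborel) = (\<integral>\<^sup>+z. f z \<partial>(distr lborel lborel (\<lambda>(x, y). Complex x y)))"
    by (simp add: distr_Complex_lborel)
  also have "\<dots> = (\<integral>\<^sup>+p. f (case_prod Complex p) \<partial>(lborel :: (real \<times> real) measure))"
    using C by (subst nn_integral_distr) auto
  also have "\<dots> = (\<integral>\<^sup>+p. f (case_prod Complex p) \<partial>(lborel \<Otimes>\<^sub>M lborel))"
    by (simp add: lborel_prod)
  finally have *: "(\<integral>\<^sup>+z. f z \<partial>lborel) = (\<integral>\<^sup>+p. f (case_prod Complex p) \<partial>(lborel \<Otimes>\<^sub>M lborel))" .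
  have m: "(\<lambda>p. f (case_prod Complex p)) \<in> borel_measurable (lborel \<Otimes>\<^sub>M lborel)"
    using C by (simp add: lborel_prod)
  show "(\<integral>\<^sup>+z. f z \<partial>lborel) = (\<integral>\<^sup>+x. (\<integral>\<^sup>+y. f (Complex x y) \<partial>lborel) \<partial>lborel)"
    using lborel.nn_integral_fst[OF m] * by simp
  show "(\<integral>\<^sup>+z. f z \<partial>lborel) = (\<integral>\<^sup>+y. (\<integral>\<^sup>+x. f (Complex x y) \<partial>lborel) \<partial>lborel)"
    using lborel_pair.nn_integral_snd[OF m] * by simp
qed

lemma nn_integral_shear:
  fixes c :: real
  assumes [measurable]: "f \<in> borel_measurable borel"
  shows "(\<integral>\<^sup>+z. f (Complex (Re z + c * Im z) (Im z)) \<partial>lborel) = (\<integral>\<^sup>+z. f z \<partial>lborel)"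
    and "(\<integral>\<^sup>+z. f (Complex (Re z) (Im z + c * Re z)) \<partial>lborel) = (\<integral>\<^sup>+z. f z \<partial>lborel)"
proof -
  have C[measurable]: "(\<lambda>z. Complex (Re z + c * Im z) (Im z)) \<in> borel_measurable borel"
      "(\<lambda>z. Complex (Re z) (Im z + c * Re z)) \<in> borel_measurable borel"
      "\<And>y. (\<lambda>x. Complex x y) \<in> borel_measurable borel"
      "\<And>x. (\<lambda>y. Complex x y) \<in> borel_measurable borel"
    by (intro borel_measurable_continuous_onI; auto simp: Complex_eq intro!: continuous_intros)+
  have "(\<integral>\<^sup>+x. g (Complex (x + c * y) y) \<partial>lborel) = (\<integral>\<^sup>+x. g (Complex x y) \<partial>lborel)"
    if [measurable]: "g \<in> borel_measurable borel" for y and g :: "complex \<Rightarrow> ennreal"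
    using nn_integral_real_affine[of "\<lambda>x. g (Complex x y)" 1 "c * y"] by (simp add: add.commute)
  then show "(\<integral>\<^sup>+z. f (Complex (Re z + c * Im z) (Im z)) \<partial>lborel) = (\<integral>\<^sup>+z. f z \<partial>lborel)"
    by (simp add: nn_integral_complex(2))
  have "(\<integral>\<^sup>+y. g (Complex x (y + c * x)) \<partial>lborel) = (\<integral>\<^sup>+y. g (Complex x y) \<partial>lborel)"
    if [measurable]: "g \<in> borel_measurable borel" for x and g :: "complex \<Rightarrow> ennreal"
    using nn_integral_real_affine[of "\<lambda>y. g (Complex x y)" 1 "c * x"] by (simp add: add.commute)
  then show "(\<integral>\<^sup>+z. f (Complex (Re z) (Im z + c * Re z)) \<partial>lborel) = (\<integral>\<^sup>+z. f z \<partial>lborel)"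
    by (simp add: nn_integral_complex(1))
qed

text \<open>
  A rotation other than the half turn is a product of three shears, and shears preserve Lebesgue
  measure by Fubini's theorem and translation invariance on the line. The shear by \<open>- tan (\<theta>/2)\<close>
  that this decomposition uses does not exist for the angle \<open>\<pi>\<close>.
\<close>

lemma distr_rotation_lborel:
  assumes u: "cmod u = 1" "u \<noteq> -1"
  shows "distr lborel borel (\<lambda>z. u * z) = (lborel :: complex measure)"
proof (rule measure_eqI)
  \<comment> \<open>For \<open>u = cis \<theta>\<close> this is \<open>- tan (\<theta>/2)\<close>, the parameter of the two outer shears; the middle one has parameter \<open>sin \<theta>\<close>.\<close>
  define c where "c = - Im u / (1 + Re u)"
  have n1: "(Re u)\<^sup>2 + (Im u)\<^sup>2 = 1"
    using u(1) by (metis cmod_power2 one_power2)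
  have "1 + Re u \<noteq> 0"
  proof
    assume "1 + Re u = 0"
    then have "Re u = -1" by simp
    then have "Im u = 0" using n1 by simp
    with \<open>Re u = -1\<close> u(2) show False by (simp add: complex_eq_iff)
  qed
  then have c: "c * (1 + Re u) = - Im u" by (simp add: c_def)
  have c2: "1 + c * Im u = Re u"
  proof -
    have "(1 + Re u) * (1 + c * Im u) = 1 + Re u + (c * (1 + Re u)) * Im u"
      by (simp add: algebra_simps)
    also have "\<dots> = 1 + Re u - (Im u)\<^sup>2"
      by (simp only: c) (simp add: power2_eq_square)
    also have "\<dots> = (1 + Re u) * Re u"
      using n1 by (simp add: algebra_simps power2_eq_square)
    finally show ?thesis using \<open>1 + Re u \<noteq> 0\<close> by simp
  qed
  have c3: "c * Re u + c = - Im u" using c by (simp add: algebra_simps)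
  define S where "S z = Complex (Re z + c * Im z) (Im z)" for z
  define R where "R z = Complex (Re z) (Im z + Im u * Re z)" for z
  have SRS: "S (R (S z)) = u * z" for z
  proof -
    have "Im (S (R (S z))) = Im (u * z)"
    proof -
      have "Im (S (R (S z))) = (1 + c * Im u) * Im z + Im u * Re z"
        by (simp add: S_def R_def algebra_simps)
      then show ?thesis by (simp only: c2) simp
    qed
    moreover have "Re (S (R (S z))) = Re (u * z)"
    proof -
      have "Re (S (R (S z))) = (1 + c * Im u) * Re z + (c * (1 + c * Im u) + c) * Im z"
        by (simp add: S_def R_def algebra_simps)
      then show ?thesis by (simp only: c2 c3) simp
    qed
    ultimately show ?thesis by (simp add: complex_eq_iff)
  qed
  have [measurable]: "S \<in> borel_measurable borel" "R \<in> borel_measurable borel"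
    unfolding S_def R_def
    by (intro borel_measurable_continuous_onI; auto simp: Complex_eq intro!: continuous_intros)+
  have inv: "(\<integral>\<^sup>+z. f (u * z) \<partial>lborel) = (\<integral>\<^sup>+z. f z \<partial>lborel)"
    if f[measurable]: "f \<in> borel_measurable borel" for f :: "complex \<Rightarrow> ennreal"
  proof -
    have S: "(\<integral>\<^sup>+z. g (S z) \<partial>lborel) = (\<integral>\<^sup>+z. g z \<partial>lborel)"
      if "g \<in> borel_measurable borel" for g :: "complex \<Rightarrow> ennreal"
      using nn_integral_shear(1)[OF that] by (simp add: S_def)
    have R: "(\<integral>\<^sup>+z. g (R z) \<partial>lborel) = (\<integral>\<^sup>+z. g z \<partial>lborel)"
      if "g \<in> borel_measurable borel" for g :: "complex \<Rightarrow> ennreal"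
      using nn_integral_shear(2)[OF that] by (simp add: R_def)
    have "(\<integral>\<^sup>+z. f (u * z) \<partial>lborel) = (\<integral>\<^sup>+z. f (S (R (S z))) \<partial>lborel)"
      by (simp add: SRS)
    also have "\<dots> = (\<integral>\<^sup>+z. f (S (R z)) \<partial>lborel)"
      by (rule S) measurable
    also have "\<dots> = (\<integral>\<^sup>+z. f (S z) \<partial>lborel)"
      by (rule R) measurable
    also have "\<dots> = (\<integral>\<^sup>+z. f z \<partial>lborel)"
      by (rule S) fact
    finally show ?thesis .
  qed
  fix A :: "complex set" assume "A \<in> sets (distr lborel borel (\<lambda>z. u * z))"
  then have A[measurable]: "A \<in> sets borel" by simp
  have "emeasure (distr lborel borel (\<lambda>z. u * z)) A = (\<integral>\<^sup>+z. indicator A z \<partial>distr lborel borel (\<lambda>z. u * z))"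
    by simp
  also have "\<dots> = (\<integral>\<^sup>+z. indicator A (u * z) \<partial>lborel)"
    by (subst nn_integral_distr) auto
  also have "\<dots> = emeasure lborel A"
    by (subst inv) auto
  finally show "emeasure (distr lborel borel (\<lambda>z. u * z)) A = emeasure lborel A" .
qed simp

lemma space_disk_area [simp]: "space disk_area = unit_disk"
  by (simp add: disk_area_def)

lemma measurable_disk_area_iff:
  "f \<in> borel_measurable disk_area \<longleftrightarrow> f \<in> borel_measurable (lebesgue_on unit_disk)"
  by (simp add: disk_area_def)

lemma borel_measurable_disk_area:
  fixes f :: "complex \<Rightarrow> 'b :: topological_space"
  assumes "f \<in> borel_measurable borel" shows "f \<in> borel_measurable disk_area"
  unfolding measurable_disk_area_iff
  by (rule measurable_restrict_space1) (use assms in \<open>simp add: measurable_completion\<close>)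

lemma measurable_ident_disk_area [measurable]: "(\<lambda>z. z) \<in> borel_measurable disk_area"
  by (rule borel_measurable_disk_area) simp

lemma holomorphic_measurable_disk_area:
  assumes "f holomorphic_on unit_disk" shows "f \<in> borel_measurable disk_area"
  unfolding measurable_disk_area_iff
  by (rule continuous_imp_measurable_on_sets_lebesgue)
     (use assms holomorphic_on_imp_continuous_on in auto)

lemma emeasure_disk_area:
  assumes A: "A \<in> sets borel" "A \<subseteq> unit_disk"
  shows "emeasure disk_area A = ennreal (1 / pi) * emeasure lborel A"
proof -
  have AL: "A \<in> sets (lebesgue_on unit_disk)"
    using A by (auto simp: sets_restrict_space)
  then have "emeasure disk_area A = (\<integral>\<^sup>+z. ennreal (1 / pi) * indicator A z \<partial>lebesgue_on unit_disk)"
    unfolding disk_area_def by (subst emeasure_density) auto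
  also have "\<dots> = ennreal (1 / pi) * emeasure (lebesgue_on unit_disk) A"
    using AL by (subst nn_integral_cmult) auto
  also have "emeasure (lebesgue_on unit_disk) A = emeasure lborel A"
    using A by (subst emeasure_restrict_space) auto
  finally show ?thesis .
qed

lemma emeasure_space_disk_area: "emeasure disk_area unit_disk = 1"
  using emeasure_ball[of 1 "0::complex"]
  by (simp add: emeasure_disk_area unit_ball_vol_2 ennreal_mult[symmetric])

interpretation disk_area: prob_space disk_area
  by standard (simp add: emeasure_space_disk_area)

text \<open>
  Reduces an integral of a Borel function over the disk, which is formed with the completed measure,
  to Lebesgue-Borel measure on the plane, where transformations are easy to apply.
\<close>

lemma integral_disk_area_lborel:
  fixes f :: "complex \<Rightarrow> complex"
  assumes [measurable]: "f \<in> borel_measurable borel"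
  shows "(LINT z|disk_area. f z) = of_real (1 / pi) * (LINT z|lborel. indicator unit_disk z *\<^sub>R f z)"
proof -
  have "f \<in> borel_measurable (lebesgue_on unit_disk)"
    using borel_measurable_disk_area[OF assms] by (simp add: measurable_disk_area_iff)
  then have "(LINT z|disk_area. f z) = (LINT z|lebesgue_on unit_disk. (1 / pi) *\<^sub>R f z)"
    unfolding disk_area_def by (subst integral_density) auto
  also have "\<dots> = of_real (1 / pi) * (LINT z|lebesgue_on unit_disk. f z)"
    by (simp add: scaleR_conv_of_real)
  also have "(LINT z|lebesgue_on unit_disk. f z) = (LINT z|lebesgue. indicator unit_disk z *\<^sub>R f z)"
    by (rule integral_restrict_space) auto
  also have "\<dots> = (LINT z|lborel. indicator unit_disk z *\<^sub>R f z)"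
    by (intro integral_completion borel_measurable_scaleR borel_measurable_indicator) (auto simp: assms)
  finally show ?thesis .
qed

lemma integral_disk_area_rotate:
  fixes f :: "complex \<Rightarrow> complex"
  assumes [measurable]: "f \<in> borel_measurable borel" and u: "cmod u = 1" "u \<noteq> -1"
  shows "(LINT z|disk_area. f (u * z)) = (LINT z|disk_area. f z)"
proof -
  have D: "unit_disk \<in> sets (borel :: complex measure)" by simp
  note [measurable] = this
  have "(LINT z|lborel. indicator unit_disk z *\<^sub>R f z)
      = (LINT z|distr lborel borel (\<lambda>z. u * z). indicator unit_disk z *\<^sub>R f z)"
    using distr_rotation_lborel[OF u] by simp
  also have "\<dots> = (LINT z|lborel. indicator unit_disk (u * z) *\<^sub>R f (u * z))"
    by (subst integral_distr) auto
  also have "(\<lambda>z. indicator unit_disk (u * z) *\<^sub>R f (u * z)) = (\<lambda>z. indicator unit_disk z *\<^sub>R f (u * z))"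
    using u by (auto simp: fun_eq_iff indicator_def norm_mult)
  finally show ?thesis by (simp add: integral_disk_area_lborel)
qed

text \<open>
  The disk of radius \<open>r\<close> has normalized area \<open>r\<^sup>2\<close>, so both sides have the same distribution
  function. This replaces polar coordinates in the computation of radial moments.
\<close>

lemma distr_cmod_power2_disk_area:
  "distr disk_area borel (\<lambda>z. (cmod z)\<^sup>2) = uniform_measure lborel {0..1}"
proof (rule cdf_unique)
  have [measurable]: "(\<lambda>z. (cmod z)\<^sup>2) \<in> borel_measurable disk_area" by measurable
  interpret D: prob_space "distr disk_area borel (\<lambda>z. (cmod z)\<^sup>2)"
    by (rule disk_area.prob_space_distr) measurable
  show "real_distribution (distr disk_area borel (\<lambda>z. (cmod z)\<^sup>2))"
    by standard auto
  interpret U: prob_space "uniform_measure lborel {0..1::real}"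
    by (rule prob_space_uniform_measure) auto
  show "real_distribution (uniform_measure lborel {0..1::real})"
    by standard auto
  show "cdf (distr disk_area borel (\<lambda>z. (cmod z)\<^sup>2)) = cdf (uniform_measure lborel {0..1})"
  proof
    fix x :: real
    have L: "cdf (distr disk_area borel (\<lambda>z. (cmod z)\<^sup>2)) x = measure disk_area {z \<in> unit_disk. (cmod z)\<^sup>2 \<le> x}"
      unfolding cdf_def by (subst measure_distr) (auto intro!: arg_cong[where f = "measure disk_area"])
    have R: "cdf (uniform_measure lborel {0..1}) x = measure lborel ({0..1} \<inter> {..x})"
      unfolding cdf_def by (subst measure_uniform_measure) auto
    consider "x < 0" | "0 \<le> x" "x < 1" | "1 \<le> x" by linarith
    then show "cdf (distr disk_area borel (\<lambda>z. (cmod z)\<^sup>2)) x = cdf (uniform_measure lborel {0..1}) x"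
    proof cases
      case 1
      then have "{z \<in> unit_disk. (cmod z)\<^sup>2 \<le> x} = {}" "{0..1} \<inter> {..x} = {}"
        by (auto simp: not_le intro: less_le_trans)
      then show ?thesis by (simp only: L R) simp
    next
      case 2
      have le: "(cmod z)\<^sup>2 \<le> x \<longleftrightarrow> cmod z \<le> sqrt x" for z :: complex
        using 2 by (metis norm_ge_zero real_sqrt_abs real_sqrt_le_iff abs_of_nonneg)
      have "sqrt x < 1" using 2 by simp
      then have lt: "cmod z < 1" if "cmod z \<le> sqrt x" for z :: complex
        using that by linarith
      then have sub: "cball 0 (sqrt x) \<subseteq> (unit_disk :: complex set)" by auto
      then have "{z \<in> unit_disk. (cmod z)\<^sup>2 \<le> x} = cball 0 (sqrt x)"
        by (auto simp: le intro: lt)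
      moreover have "emeasure disk_area (cball 0 (sqrt x)) = ennreal x"
        using sub 2 emeasure_cball[of "sqrt x" "0::complex"]
        by (simp add: emeasure_disk_area unit_ball_vol_2 ennreal_mult[symmetric])
      moreover have "{0..1} \<inter> {..x} = {0..x}" using 2 by auto
      ultimately show ?thesis using 2 by (simp add: L R measure_def)
    next
      case 3
      have "{z \<in> unit_disk. (cmod z)\<^sup>2 \<le> x} = ball 0 1"
        using 3 by (auto intro!: order.trans[OF power_le_one])
      moreover have "{0..1} \<inter> {..x} = {0..1}" using 3 by auto
      ultimately show ?thesis by (simp add: L R measure_def emeasure_space_disk_area)
    qed
  qed
qed

section \<open>Radial moments\<close>

lemma borel_measurable_cnj [measurable (raw)]:
  "f \<in> borel_measurable M \<Longrightarrow> (\<lambda>x. cnj (f x)) \<in> borel_measurable M"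
  by (rule borel_measurable_continuous_on[OF continuous_on_cnj[OF continuous_on_id]])

lemma integral_cmod_powr:
  assumes "x \<ge> 0"
  shows "(LINT z|disk_area. cmod z powr (2 * x)) = 1 / (x + 1)"
proof -
  have sq: "cmod z powr (2 * x) = ((cmod z)\<^sup>2) powr x" for z :: complex
    by (cases "z = 0") (simp_all add: powr_powr flip: powr_numeral)
  have "(LINT z|disk_area. cmod z powr (2 * x))
      = (LINT r|distr disk_area borel (\<lambda>z. (cmod z)\<^sup>2). r powr x)"
    unfolding sq by (subst integral_distr) auto
  also have "\<dots> = (LINT r|uniform_measure lborel {0..1}. r powr x)"
    by (simp add: distr_cmod_power2_disk_area)
  also have "\<dots> = (LINT r|lborel. indicator {0..1} r *\<^sub>R (r powr x))"
  proof -
    have "uniform_measure lborel {0..1::real} = density lborel (\<lambda>r. ennreal (indicator {0..1} r))"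
      by (simp add: uniform_measure_def ennreal_indicator divide_ennreal_def)
    then show ?thesis by (simp add: integral_density)
  qed
  also have "\<dots> = (LINT r:{0..1}|lborel. r powr x)"
    by (simp add: set_lebesgue_integral_def)
  also have "\<dots> = integral {0..1} (\<lambda>r. r powr x)"
  proof (rule set_borel_integral_eq_integral)
    show "set_integrable lborel {0..1} (\<lambda>r. r powr x)"
      unfolding set_integrable_def
    proof (rule Bochner_Integration.integrable_bound[where f = "\<lambda>r. indicator {0..1::real} r *\<^sub>R (1::real)"])
      show "AE r in lborel. norm (indicator {0..1} r *\<^sub>R (r powr x)) \<le> norm (indicator {0..1::real} r *\<^sub>R (1::real))"
        using assms by (auto simp: indicator_def powr_le1)
    qed auto
  qed
  also have "\<dots> = 1 / (x + 1)"
    using has_integral_powr_from_0[of x 1] assms by (simp add: integral_unique)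
  finally show ?thesis .
qed

text \<open>
  The exponent \<open>x\<close> is positive because \<open>0 powr 0 = 0\<close> whereas \<open>0 ^ 0 = 1\<close>; the unweighted moments
  are treated separately.
\<close>

lemma integral_cmod_powr_power:
  assumes "x > 0"
  shows "(LINT z|disk_area. cmod z powr (2 * x) * cmod z ^ (2 * k)) = 1 / (real k + x + 1)"
proof -
  have "cmod z powr (2 * x) * cmod z ^ (2 * k) = cmod z powr (2 * (real k + x))" for z :: complex
    using assms by (cases "z = 0") (auto simp: powr_add powr_realpow[symmetric] algebra_simps)
  then show ?thesis using integral_cmod_powr[of "real k + x"] assms by simp
qed

lemma integral_cmod_power: "(LINT z|disk_area. cmod z ^ (2 * k)) = 1 / (real k + 1)"
proof (cases "k = 0")
  case False
  have "cmod z ^ (2 * k) = cmod z powr (2 * real k)" for z :: complex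
    using False by (cases "z = 0") (auto simp: powr_realpow[symmetric])
  then show ?thesis using integral_cmod_powr[of "real k"] by simp
qed (use disk_area.prob_space in simp)

text \<open>
  For \<open>i \<noteq> j\<close>, rotation by \<open>u\<close> multiplies the integrand by \<open>u ^ i * cnj u ^ j\<close> and leaves the
  integral unchanged, so the integral vanishes as soon as some \<open>u\<close> makes this factor different
  from \<open>1\<close>.
\<close>

lemma integral_radial_monomials:
  assumes [measurable]: "w \<in> borel_measurable (borel :: real measure)"
  shows "(LINT z|disk_area. of_real (w (cmod z)) * z ^ i * cnj z ^ j) =
         (if i = j then of_real (LINT z|disk_area. w (cmod z) * cmod z ^ (2 * i)) else 0)"
proof (cases "i = j")
  case True
  have "of_real (w (cmod z)) * z ^ i * cnj z ^ i = complex_of_real (w (cmod z) * cmod z ^ (2 * i))" for z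
  proof -
    have "z ^ i * cnj z ^ i = complex_of_real (cmod z ^ (2 * i))"
      using complex_norm_square[of z] by (simp add: power_mult flip: power_mult_distrib)
    then show ?thesis by (simp add: mult.assoc)
  qed
  then show ?thesis using True by (simp only: integral_complex_of_real if_True refl)
next
  case False
  \<comment> \<open>With this angle the factor \<open>u ^ i * cnj u ^ j\<close> is \<open>\<i>\<close> or \<open>- \<i>\<close>, and \<open>u\<close> stays away from \<open>- 1\<close>.\<close>
  define \<theta> where "\<theta> = pi / (2 * \<bar>real i - real j\<bar>)"
  define u where "u = cis \<theta>"
  have ij: "\<bar>real i - real j\<bar> \<ge> 1" using False by linarith
  have \<theta>: "0 < \<theta>" "\<theta> \<le> pi / 2"
    using ij unfolding \<theta>_def by (auto simp: field_simps)
  have u1: "cmod u = 1" by (simp add: u_def)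
  have u2: "u \<noteq> -1"
  proof
    assume "u = -1"
    then have "cos \<theta> = -1" by (simp add: u_def complex_eq_iff)
    moreover have "cos \<theta> \<ge> 0" using \<theta> by (intro cos_ge_zero) auto
    ultimately show False by simp
  qed
  have uij: "u ^ i * cnj u ^ j \<noteq> 1"
  proof
    have "cis (real i * \<theta>) * cis (real j * - \<theta>) = cis (\<theta> * (real i - real j))"
      unfolding cis_mult by (rule arg_cong[where f = cis]) (simp add: algebra_simps)
    then have "u ^ i * cnj u ^ j = cis (\<theta> * (real i - real j))"
      by (simp only: u_def cis_cnj Complex.DeMoivre)
    moreover assume "u ^ i * cnj u ^ j = 1"
    ultimately have "cos (\<theta> * (real i - real j)) = 1" by (metis cis.sel(1) one_complex.sel(1))
    moreover have "\<theta> * (real i - real j) = pi / 2 \<or> \<theta> * (real i - real j) = - (pi / 2)"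
      using ij False unfolding \<theta>_def by (auto simp: field_simps abs_if split: if_splits)
    ultimately show False by (metis cos_minus cos_pi_half zero_neq_one)
  qed
  define F where "F z = of_real (w (cmod z)) * z ^ i * cnj z ^ j" for z :: complex
  have [measurable]: "F \<in> borel_measurable borel" unfolding F_def by measurable
  have "F (u * z) = (u ^ i * cnj u ^ j) * F z" for z
    using u1 by (simp add: F_def norm_mult power_mult_distrib)
  then have "(LINT z|disk_area. F z) = (LINT z|disk_area. (u ^ i * cnj u ^ j) * F z)"
    using integral_disk_area_rotate[of F u] u1 u2 by simp
  also have "\<dots> = (u ^ i * cnj u ^ j) * (LINT z|disk_area. F z)"
    by (rule integral_mult_right_zero)
  finally have "(LINT z|disk_area. F z) = 0"
    using uij by (simp add: algebra_simps)
  then show ?thesis using False by (simp add: F_def)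
qed

text \<open>
  On a smaller disk the power series is dominated by a constant, so it can be integrated term by term;
  only the \<open>k\<close>-th term survives.
\<close>

lemma integral_radial_power_series_cutoff:
  assumes sums: "\<And>z. cmod z < 1 \<Longrightarrow> (\<lambda>k. c k * z ^ k) sums f z"
    and w[measurable]: "w \<in> borel_measurable (borel :: real measure)"
    and B: "\<And>r. 0 \<le> r \<Longrightarrow> r < 1 \<Longrightarrow> \<bar>w r\<bar> \<le> B"
    and \<rho>: "0 \<le> \<rho>" "\<rho> < 1" "\<And>r. r > \<rho> \<Longrightarrow> w r = 0"
  shows "(LINT z|disk_area. of_real (w (cmod z)) * f z * cnj z ^ k) =
         c k * of_real (LINT z|disk_area. w (cmod z) * cmod z ^ (2 * k))"
    (is "?L = ?R")
proof -
  have "f holomorphic_on unit_disk"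
    using sums by (intro power_series_holomorphic[of 0 1 c f]) auto
  then have [measurable]: "f \<in> borel_measurable disk_area" by (rule holomorphic_measurable_disk_area)
  define S where "S M z = (\<Sum>i<M. c i * z ^ i)" for M and z :: complex
  have B0: "0 \<le> B" using B[of 0] by linarith
  define C where "C = (\<Sum>i. cmod (c i) * \<rho> ^ i)"
  have sumC: "summable (\<lambda>i. cmod (c i) * \<rho> ^ i)"
  proof -
    \<comment> \<open>Convergence at a point of larger modulus gives absolute convergence at radius \<open>\<rho>\<close>.\<close>
    define q :: complex where "q = of_real ((\<rho> + 1) / 2)"
    have q: "cmod q = (\<rho> + 1) / 2" using \<rho> unfolding q_def by (simp only: norm_of_real) simp
    have "summable (\<lambda>i. c i * q ^ i)"
      by (rule sums_summable[OF sums]) (use q \<rho> in simp)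
    then have "summable (\<lambda>i. norm (c i * of_real \<rho> ^ i))"
      by (rule powser_insidea) (use q \<rho> in simp)
    then show ?thesis using \<rho> by (simp add: norm_mult norm_power)
  qed
  have [measurable]: "S M \<in> borel_measurable disk_area" for M
    by (simp add: S_def[abs_def])
  have lim: "(\<lambda>M. LINT z|disk_area. of_real (w (cmod z)) * S M z * cnj z ^ k) \<longlonglongrightarrow> ?L"
  proof (rule integral_dominated_convergence[where w = "\<lambda>_. B * C"])
    show "AE z in disk_area. (\<lambda>M. of_real (w (cmod z)) * S M z * cnj z ^ k) \<longlonglongrightarrow> of_real (w (cmod z)) * f z * cnj z ^ k"
      using sums
      by (intro AE_I2 tendsto_intros) (simp add: sums_def S_def)
    show "AE z in disk_area. norm (of_real (w (cmod z)) * S M z * cnj z ^ k) \<le> B * C" for M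
    proof (rule AE_I2)
      fix z assume "z \<in> space disk_area"
      then have z: "cmod z < 1" by simp
      show "norm (of_real (w (cmod z)) * S M z * cnj z ^ k) \<le> B * C"
      proof (cases "cmod z \<le> \<rho>")
        case True
        have "cmod (S M z) \<le> (\<Sum>i<M. cmod (c i) * \<rho> ^ i)"
          unfolding S_def
          by (rule sum_norm_le) (use True in \<open>auto simp: norm_mult norm_power intro!: mult_left_mono power_mono\<close>)
        also have "\<dots> \<le> C"
          unfolding C_def by (rule sum_le_suminf[OF sumC]) (use \<rho> in auto)
        finally have "cmod (S M z) \<le> C" .
        moreover from this have "0 \<le> C" using norm_ge_zero order.trans by blast
        ultimately have "\<bar>w (cmod z)\<bar> * cmod (S M z) * cmod z ^ k \<le> B * C * 1"
          using B[of "cmod z"] z B0 by (intro mult_mono) (auto simp: power_le_one)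
        then show ?thesis by (simp add: norm_mult norm_power)
      next
        case False
        then show ?thesis using \<rho> B0 sumC
          by (auto simp: C_def intro!: mult_nonneg_nonneg suminf_nonneg)
      qed
    qed
  qed auto
  have int: "integrable disk_area (\<lambda>z. of_real (w (cmod z)) * z ^ i * cnj z ^ k)" for i
  proof (rule disk_area.integrable_const_bound[where B = B])
    show "AE z in disk_area. norm (of_real (w (cmod z)) * z ^ i * cnj z ^ k) \<le> B"
    proof (rule AE_I2)
      fix z assume "z \<in> space disk_area"
      then have "\<bar>w (cmod z)\<bar> * cmod z ^ i * cmod z ^ k \<le> B * 1 * 1"
        using B0 B[of "cmod z"] by (intro mult_mono) (auto simp: power_le_one)
      then show "norm (of_real (w (cmod z)) * z ^ i * cnj z ^ k) \<le> B"
        by (simp add: norm_mult norm_power)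
    qed
  qed auto
  have "(LINT z|disk_area. of_real (w (cmod z)) * S M z * cnj z ^ k) = ?R" if "M > k" for M
  proof -
    have "of_real (w (cmod z)) * S M z * cnj z ^ k = (\<Sum>i<M. c i * (of_real (w (cmod z)) * z ^ i * cnj z ^ k))" for z
      by (simp add: S_def sum_distrib_left sum_distrib_right mult_ac)
    then have "(LINT z|disk_area. of_real (w (cmod z)) * S M z * cnj z ^ k)
        = (\<Sum>i<M. c i * (LINT z|disk_area. of_real (w (cmod z)) * z ^ i * cnj z ^ k))"
      using int by simp
    also have "\<dots> = (\<Sum>i<M. if i = k then ?R else 0)"
      by (rule sum.cong) (auto simp: integral_radial_monomials)
    also have "\<dots> = ?R" using that by simp
    finally show ?thesis .
  qed
  then have "\<forall>\<^sub>F M in sequentially. (LINT z|disk_area. of_real (w (cmod z)) * S M z * cnj z ^ k) = ?R"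
    by (intro eventually_sequentiallyI[of "Suc k"]) auto
  then have "(\<lambda>M. LINT z|disk_area. of_real (w (cmod z)) * S M z * cnj z ^ k) \<longlonglongrightarrow> ?R"
    by (rule tendsto_eventually)
  with lim show ?thesis by (rule LIMSEQ_unique)
qed

text \<open>
  The weight is cut off at radii tending to \<open>1\<close>, and dominated convergence with the integrable
  function \<open>B * cmod (f z)\<close> removes the cutoff.
\<close>

lemma integral_radial_power_series:
  assumes sums: "\<And>z. cmod z < 1 \<Longrightarrow> (\<lambda>k. c k * z ^ k) sums f z"
    and f: "integrable disk_area f"
    and w[measurable]: "w \<in> borel_measurable (borel :: real measure)"
    and B: "\<And>r. 0 \<le> r \<Longrightarrow> r < 1 \<Longrightarrow> \<bar>w r\<bar> \<le> B"
  shows "(LINT z|disk_area. of_real (w (cmod z)) * f z * cnj z ^ k) =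
         c k * of_real (LINT z|disk_area. w (cmod z) * cmod z ^ (2 * k))"
proof -
  define \<rho> where "\<rho> j = 1 - 1 / (real j + 2)" for j :: nat
  have \<rho>: "0 \<le> \<rho> j" "\<rho> j < 1" for j by (auto simp: \<rho>_def field_simps)
  define v where "v j r = (if r \<le> \<rho> j then w r else 0)" for j r
  have [measurable]: "v j \<in> borel_measurable borel" for j unfolding v_def by measurable
  have [measurable]: "f \<in> borel_measurable disk_area" using f by (rule borel_measurable_integrable)
  have B0: "0 \<le> B" using B[of 0] by linarith
  have vB: "\<bar>v j r\<bar> \<le> B" if "0 \<le> r" "r < 1" for j r using B that B0 by (auto simp: v_def)
  have vlim: "(\<lambda>j. v j r) \<longlonglongrightarrow> w r" if "r < 1" for r
  proof (rule tendsto_eventually)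
    have "\<rho> \<longlonglongrightarrow> 1" unfolding \<rho>_def by real_asymp
    then have "\<forall>\<^sub>F j in sequentially. r < \<rho> j" using that by (rule order_tendstoD)
    then show "\<forall>\<^sub>F j in sequentially. v j r = w r" by eventually_elim (simp add: v_def)
  qed
  have meas: "(\<lambda>z. of_real (w (cmod z)) * f z * cnj z ^ k) \<in> borel_measurable disk_area"
     "(\<lambda>z. of_real (v j (cmod z)) * f z * cnj z ^ k) \<in> borel_measurable disk_area" for j
    by measurable
  have lim: "(\<lambda>j. LINT z|disk_area. of_real (v j (cmod z)) * f z * cnj z ^ k) \<longlonglongrightarrow>
      (LINT z|disk_area. of_real (w (cmod z)) * f z * cnj z ^ k)"
  proof (rule integral_dominated_convergence[where w = "\<lambda>z. B * cmod (f z)"])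
    show "integrable disk_area (\<lambda>z. B * cmod (f z))" using f by auto
    show "AE z in disk_area. (\<lambda>j. of_real (v j (cmod z)) * f z * cnj z ^ k) \<longlonglongrightarrow> of_real (w (cmod z)) * f z * cnj z ^ k"
      by (intro AE_I2 tendsto_intros vlim) auto
    show "AE z in disk_area. norm (of_real (v j (cmod z)) * f z * cnj z ^ k) \<le> B * cmod (f z)" for j
    proof (rule AE_I2)
      fix z assume "z \<in> space disk_area"
      then have "\<bar>v j (cmod z)\<bar> * cmod (f z) * cmod z ^ k \<le> B * cmod (f z) * 1"
        using B0 vB[of "cmod z"] by (intro mult_mono) (auto simp: power_le_one)
      then show "norm (of_real (v j (cmod z)) * f z * cnj z ^ k) \<le> B * cmod (f z)"
        by (simp add: norm_mult norm_power)
    qed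
  qed (fact meas)+
  have eq: "(LINT z|disk_area. of_real (v j (cmod z)) * f z * cnj z ^ k) =
      c k * of_real (LINT z|disk_area. v j (cmod z) * cmod z ^ (2 * k))" for j
    by (rule integral_radial_power_series_cutoff[OF sums, where B = B and \<rho> = "\<rho> j"])
       (use \<rho> vB in \<open>auto simp: v_def\<close>)
  have "(\<lambda>j. LINT z|disk_area. v j (cmod z) * cmod z ^ (2 * k)) \<longlonglongrightarrow>
      (LINT z|disk_area. w (cmod z) * cmod z ^ (2 * k))"
  proof (rule integral_dominated_convergence[where w = "\<lambda>z. B"])
    show "AE z in disk_area. (\<lambda>j. v j (cmod z) * cmod z ^ (2 * k)) \<longlonglongrightarrow> w (cmod z) * cmod z ^ (2 * k)"
      by (intro AE_I2 tendsto_intros vlim) auto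
    show "AE z in disk_area. norm (v j (cmod z) * cmod z ^ (2 * k)) \<le> B" for j
    proof (rule AE_I2)
      fix z assume "z \<in> space disk_area"
      then have "\<bar>v j (cmod z)\<bar> * cmod z ^ (2 * k) \<le> B * 1"
        using B0 vB[of "cmod z"] by (intro mult_mono) (auto simp: power_le_one)
      then show "norm (v j (cmod z) * cmod z ^ (2 * k)) \<le> B"
        by (simp add: abs_mult)
    qed
  qed auto
  then have "(\<lambda>j. c k * of_real (LINT z|disk_area. v j (cmod z) * cmod z ^ (2 * k))) \<longlonglongrightarrow>
      c k * of_real (LINT z|disk_area. w (cmod z) * cmod z ^ (2 * k))"
    by (intro tendsto_intros)
  with lim[unfolded eq] show ?thesis by (rule LIMSEQ_unique)
qed

section \<open>Square-integrable functions on the disk\<close>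

definition square_integrable :: "(complex \<Rightarrow> complex) \<Rightarrow> bool"
  where "square_integrable f \<longleftrightarrow> f \<in> borel_measurable disk_area \<and> integrable disk_area (\<lambda>z. (cmod (f z))\<^sup>2)"

lemma square_integrable_measurable:
  "square_integrable f \<Longrightarrow> f \<in> borel_measurable disk_area"
  by (simp add: square_integrable_def)

lemma square_integrable_bounded_mult:
  assumes "square_integrable f" and [measurable]: "b \<in> borel_measurable disk_area"
    and B: "\<And>z. cmod z < 1 \<Longrightarrow> cmod (b z) \<le> B"
  shows "square_integrable (\<lambda>z. b z * f z)"
    and "L2_norm (\<lambda>z. b z * f z) \<le> B * L2_norm f"
proof -
  have [measurable]: "f \<in> borel_measurable disk_area"
    and int: "integrable disk_area (\<lambda>z. (cmod (f z))\<^sup>2)"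
    using assms(1) by (auto simp: square_integrable_def)
  have B0: "0 \<le> B" using order.trans[OF norm_ge_zero B[of 0]] by simp
  have le: "(cmod (b z * f z))\<^sup>2 \<le> B\<^sup>2 * (cmod (f z))\<^sup>2" if "cmod z < 1" for z
    using B[OF that] by (auto simp: norm_mult power_mult_distrib intro!: mult_right_mono power_mono)
  have int': "integrable disk_area (\<lambda>z. (cmod (b z * f z))\<^sup>2)"
    by (rule Bochner_Integration.integrable_bound[where f = "\<lambda>z. B\<^sup>2 * (cmod (f z))\<^sup>2"])
       (use int le in \<open>auto intro!: AE_I2\<close>)
  then show "square_integrable (\<lambda>z. b z * f z)" by (simp add: square_integrable_def)
  have "(LINT z|disk_area. (cmod (b z * f z))\<^sup>2) \<le> (LINT z|disk_area. B\<^sup>2 * (cmod (f z))\<^sup>2)"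
    by (rule integral_mono_AE) (use int int' le in \<open>auto intro!: AE_I2\<close>)
  then have "L2_norm (\<lambda>z. b z * f z) \<le> sqrt (B\<^sup>2 * (LINT z|disk_area. (cmod (f z))\<^sup>2))"
    unfolding L2_norm_def by (intro real_sqrt_le_mono) simp
  then show "L2_norm (\<lambda>z. b z * f z) \<le> B * L2_norm f"
    using B0 by (simp add: L2_norm_def real_sqrt_mult)
qed

lemma square_integrable_mult_const: "square_integrable f \<Longrightarrow> square_integrable (\<lambda>z. c * f z)"
  by (rule square_integrable_bounded_mult[where B = "cmod c"]) auto

lemma integrable_inner:
  assumes "square_integrable f" "square_integrable g"
  shows "integrable disk_area (\<lambda>z. f z * cnj (g z))"
proof (rule Bochner_Integration.integrable_bound)
  show "integrable disk_area (\<lambda>z. (cmod (f z))\<^sup>2 + (cmod (g z))\<^sup>2)"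
    using assms by (auto simp: square_integrable_def)
  show "(\<lambda>z. f z * cnj (g z)) \<in> borel_measurable disk_area"
    using assms[THEN square_integrable_measurable] by measurable
  show "AE z in disk_area. norm (f z * cnj (g z)) \<le> norm ((cmod (f z))\<^sup>2 + (cmod (g z))\<^sup>2)"
  proof (rule AE_I2)
    fix z
    have "2 * (cmod (f z) * cmod (g z)) \<le> (cmod (f z))\<^sup>2 + (cmod (g z))\<^sup>2"
      using sum_squares_bound[of "cmod (f z)" "cmod (g z)"] by simp
    moreover have "0 \<le> cmod (f z) * cmod (g z)" by simp
    ultimately show "norm (f z * cnj (g z)) \<le> norm ((cmod (f z))\<^sup>2 + (cmod (g z))\<^sup>2)"
      unfolding norm_mult complex_mod_cnj real_norm_def by linarith
  qed
qed

lemma cmod_add_power2: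
  "complex_of_real ((cmod (x + y))\<^sup>2) = of_real ((cmod x)\<^sup>2) + of_real ((cmod y)\<^sup>2) + x * cnj y + y * cnj x"
  unfolding complex_norm_square complex_cnj_add by (simp add: algebra_simps)

lemma square_integrable_add:
  assumes "square_integrable f" "square_integrable g"
  shows "square_integrable (\<lambda>z. f z + g z)"
proof -
  have "integrable disk_area (\<lambda>z. complex_of_real ((cmod (f z + g z))\<^sup>2))"
    unfolding cmod_add_power2
    using assms integrable_inner[OF assms] integrable_inner[OF assms(2,1)]
    by (intro Bochner_Integration.integrable_add) (auto simp: square_integrable_def simp del: of_real_power)
  moreover have "(\<lambda>z. f z + g z) \<in> borel_measurable disk_area"
    using assms by (intro borel_measurable_add square_integrable_measurable)
  ultimately show ?thesis
    unfolding square_integrable_def complex_of_real_integrable_eq by simp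
qed

lemma square_integrable_diff:
  assumes "square_integrable f" "square_integrable g"
  shows "square_integrable (\<lambda>z. f z - g z)"
  using square_integrable_add[OF assms(1) square_integrable_mult_const[OF assms(2), of "-1"]] by simp

lemma square_integrable_power: "square_integrable (\<lambda>z. z ^ k)"
  unfolding square_integrable_def
  by (intro conjI disk_area.integrable_const_bound[where B = 1] AE_I2)
     (auto simp: norm_power power_le_one)

lemma square_integrable_sum:
  "(\<And>i. i \<in> A \<Longrightarrow> square_integrable (f i)) \<Longrightarrow> square_integrable (\<lambda>z. \<Sum>i\<in>A. f i z)"
proof (induction A rule: infinite_finite_induct)
  case (insert x F)
  then show ?case using square_integrable_add[of "f x" "\<lambda>z. \<Sum>i\<in>F. f i z"] by simp
qed (auto simp: square_integrable_def)

lemma square_integrable_integrable: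
  "square_integrable f \<Longrightarrow> integrable disk_area f"
  using integrable_inner[of f "\<lambda>z. z ^ 0"] square_integrable_power[of 0] by simp

lemma L2_inner_cong: "(\<And>z. cmod z < 1 \<Longrightarrow> f z = f' z) \<Longrightarrow> (\<And>z. cmod z < 1 \<Longrightarrow> g z = g' z) \<Longrightarrow> L2_inner f g = L2_inner f' g'"
  unfolding L2_inner_def by (intro Bochner_Integration.integral_cong) auto

lemma L2_inner_commute: "L2_inner g f = cnj (L2_inner f g)"
  unfolding L2_inner_def Bochner_Integration.integral_cnj[symmetric] by (simp add: mult.commute)

lemma L2_inner_add_left:
  "square_integrable f \<Longrightarrow> square_integrable g \<Longrightarrow> square_integrable h \<Longrightarrow>
    L2_inner (\<lambda>z. f z + g z) h = L2_inner f h + L2_inner g h"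
  unfolding L2_inner_def by (simp add: ring_distribs integrable_inner)

lemma L2_inner_diff_left:
  "square_integrable f \<Longrightarrow> square_integrable g \<Longrightarrow> square_integrable h \<Longrightarrow>
    L2_inner (\<lambda>z. f z - g z) h = L2_inner f h - L2_inner g h"
  unfolding L2_inner_def by (simp add: ring_distribs integrable_inner)

lemma L2_inner_diff_right:
  "square_integrable f \<Longrightarrow> square_integrable g \<Longrightarrow> square_integrable h \<Longrightarrow>
    L2_inner h (\<lambda>z. f z - g z) = L2_inner h f - L2_inner h g"
  unfolding L2_inner_def by (simp add: ring_distribs integrable_inner)

lemma L2_inner_mult_left: "L2_inner (\<lambda>z. c * f z) h = c * L2_inner f h"
  unfolding L2_inner_def by (simp add: mult.assoc)

lemma L2_inner_sum_right:
  assumes "square_integrable h" "\<And>i. i \<in> A \<Longrightarrow> square_integrable (f i)"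
  shows "L2_inner h (\<lambda>z. \<Sum>i\<in>A. c i * f i z) = (\<Sum>i\<in>A. cnj (c i) * L2_inner h (f i))"
proof -
  have "L2_inner h (\<lambda>z. \<Sum>i\<in>A. c i * f i z) = (LINT z|disk_area. (\<Sum>i\<in>A. cnj (c i) * (h z * cnj (f i z))))"
    unfolding L2_inner_def by (simp add: sum_distrib_left mult_ac)
  also have "\<dots> = (\<Sum>i\<in>A. cnj (c i) * L2_inner h (f i))"
    unfolding L2_inner_def using assms integrable_inner
    by (subst Bochner_Integration.integral_sum) (auto simp: integrable_inner)
  finally show ?thesis .
qed

lemma L2_inner_self: "L2_inner f f = of_real (LINT z|disk_area. (cmod (f z))\<^sup>2)"
  unfolding L2_inner_def complex_norm_square[symmetric] by (rule integral_complex_of_real)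

lemma L2_norm_power2: "(L2_norm f)\<^sup>2 = (LINT z|disk_area. (cmod (f z))\<^sup>2)"
  unfolding L2_norm_def by simp

lemma Cauchy_Schwarz_L2_inner:
  assumes "square_integrable f" "square_integrable g"
  shows "cmod (L2_inner f g) \<le> L2_norm f * L2_norm g"
proof -
  have [measurable]: "f \<in> borel_measurable disk_area" "g \<in> borel_measurable disk_area"
    using assms by (auto simp: square_integrable_def)
  have int: "integrable disk_area (\<lambda>z. cmod (f z) * cmod (g z))"
    using integrable_norm[OF integrable_inner[OF assms]] by (simp add: norm_mult)
  define I where "I = (LINT z|disk_area. cmod (f z) * cmod (g z))"
  have I0: "0 \<le> I" unfolding I_def by simp
  have sq: "(\<integral>\<^sup>+z. (ennreal (cmod (h z)))\<^sup>2 \<partial>disk_area) = ennreal ((L2_norm h)\<^sup>2)"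
    if "square_integrable h" for h
    unfolding L2_norm_power2 ennreal_power[OF norm_ge_zero] using that
    by (intro nn_integral_eq_integral) (auto simp: square_integrable_def)
  have "ennreal (I\<^sup>2) = (\<integral>\<^sup>+z. ennreal (cmod (f z)) * ennreal (cmod (g z)) \<partial>disk_area)\<^sup>2"
    unfolding I_def ennreal_power[OF I0[unfolded I_def], symmetric]
    using nn_integral_eq_integral[OF int] by (simp add: ennreal_mult)
  also have "\<dots> \<le> (\<integral>\<^sup>+z. (ennreal (cmod (f z)))\<^sup>2 \<partial>disk_area) * (\<integral>\<^sup>+z. (ennreal (cmod (g z)))\<^sup>2 \<partial>disk_area)"
    by (rule Cauchy_Schwarz_nn_integral) measurable
  also have "\<dots> = ennreal ((L2_norm f * L2_norm g)\<^sup>2)"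
    by (simp add: sq assms ennreal_mult power_mult_distrib)
  finally have "I\<^sup>2 \<le> (L2_norm f * L2_norm g)\<^sup>2"
    by (simp add: ennreal_le_iff)
  then have "I \<le> L2_norm f * L2_norm g"
    by (rule power2_le_imp_le) (simp add: L2_norm_def)
  moreover have "cmod (L2_inner f g) \<le> I"
    unfolding I_def L2_inner_def
    using integral_norm_bound[of disk_area "\<lambda>z. f z * cnj (g z)"] by (simp add: norm_mult)
  ultimately show ?thesis by simp
qed

lemma L2_inner_monomials: "L2_inner (\<lambda>z. z ^ i) (\<lambda>z. z ^ j) = (if i = j then 1 / (of_nat i + 1) else 0)"
  using integral_radial_monomials[of "\<lambda>_. 1" i j]
  by (simp add: L2_inner_def integral_cmod_power)

text \<open>
  For a function in the Bergman space these are the Taylor coefficients at \<open>0\<close>, as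
  \<open>bergman_space_eq_series\<close> shows. Defining them by inner products makes them available for every
  square-integrable function, for which they are the coefficients of the Bergman projection.
\<close>

definition bergman_coeff :: "(complex \<Rightarrow> complex) \<Rightarrow> nat \<Rightarrow> complex"
  where "bergman_coeff h k = (of_nat k + 1) * L2_inner h (\<lambda>z. z ^ k)"

text \<open>
  The factor \<open>k + 1\<close> in the coefficient is the inverse of the squared norm of \<open>z ^ k\<close>.
\<close>

lemma L2_inner_power: "L2_inner h (\<lambda>z. z ^ k) = bergman_coeff h k / (of_nat k + 1)"
proof -
  have "(of_nat k + 1 :: complex) \<noteq> 0"
    by (metis of_nat_Suc of_nat_neq_0 add.commute)
  then show ?thesis by (simp add: bergman_coeff_def)
qed

text \<open>
  Pythagoras: the partial sum is the orthogonal projection onto the polynomials of degree below \<open>M\<close>.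
\<close>

lemma integral_diff_partial_sum:
  assumes h: "square_integrable h"
  shows "(LINT z|disk_area. (cmod (h z - (\<Sum>k<M. bergman_coeff h k * z ^ k)))\<^sup>2)
       = (LINT z|disk_area. (cmod (h z))\<^sup>2) - (\<Sum>k<M. (cmod (bergman_coeff h k))\<^sup>2 / (real k + 1))"
proof -
  define c where "c = bergman_coeff h"
  define p where "p z = (\<Sum>k<M. c k * z ^ k)" for z
  define E where "E = (\<Sum>k<M. (cmod (c k))\<^sup>2 / (real k + 1))"
  have p: "square_integrable p" unfolding p_def
    by (intro square_integrable_sum square_integrable_mult_const square_integrable_power)
  have tm: "cnj (c k) * (c k / (of_nat k + 1)) = of_real ((cmod (c k))\<^sup>2 / (real k + 1))" for k
    by (simp add: complex_norm_square mult.commute del: of_real_power)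
  have hp: "L2_inner h p = of_real E"
  proof -
    have "L2_inner h p = (\<Sum>k<M. cnj (c k) * (c k / (of_nat k + 1)))"
      using L2_inner_sum_right[OF h, of "{..<M}" "\<lambda>k z. z ^ k" c, folded p_def]
      by (simp add: square_integrable_power L2_inner_power c_def)
    then show ?thesis by (simp only: tm E_def of_real_sum)
  qed
  have "L2_inner p (\<lambda>z. z ^ k) = c k / (of_nat k + 1)" if "k < M" for k
  proof -
    have "L2_inner p (\<lambda>z. z ^ k) = cnj (L2_inner (\<lambda>z. z ^ k) p)" by (rule L2_inner_commute)
    also have "\<dots> = (\<Sum>i<M. c i * cnj (L2_inner (\<lambda>z. z ^ k) (\<lambda>z. z ^ i)))"
      unfolding p_def by (subst L2_inner_sum_right) (auto simp: square_integrable_power)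
    also have "\<dots> = (\<Sum>i<M. if i = k then c k / (of_nat k + 1) else 0)"
      by (intro sum.cong) (auto simp: L2_inner_monomials)
    finally show ?thesis using that by simp
  qed
  then have pp: "L2_inner p p = of_real E"
  proof -
    assume *: "\<And>k. k < M \<Longrightarrow> L2_inner p (\<lambda>z. z ^ k) = c k / (of_nat k + 1)"
    have "L2_inner p p = (\<Sum>k<M. cnj (c k) * L2_inner p (\<lambda>z. z ^ k))"
      using L2_inner_sum_right[OF p, of "{..<M}" "\<lambda>k z. z ^ k" c, folded p_def]
      by (simp add: square_integrable_power)
    also have "\<dots> = (\<Sum>k<M. cnj (c k) * (c k / (of_nat k + 1)))"
      using * by (intro sum.cong) auto
    finally show ?thesis by (simp only: tm E_def of_real_sum)
  qed
  have hh: "L2_inner h h = of_real (LINT z|disk_area. (cmod (h z))\<^sup>2)" by (rule L2_inner_self)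
  have "L2_inner (\<lambda>z. h z - p z) (\<lambda>z. h z - p z) = L2_inner h h - L2_inner h p - (L2_inner p h - L2_inner p p)"
    using h p by (simp add: L2_inner_diff_left L2_inner_diff_right square_integrable_diff)
  also have "L2_inner p h = of_real E" using L2_inner_commute[of p h] hp by simp
  finally have "L2_inner (\<lambda>z. h z - p z) (\<lambda>z. h z - p z) = of_real ((LINT z|disk_area. (cmod (h z))\<^sup>2) - E)"
    unfolding hp pp hh by simp
  then show ?thesis
    unfolding L2_inner_self of_real_eq_iff by (simp add: p_def E_def c_def)
qed

lemma Bessel_inequality:
  assumes "square_integrable h"
  shows "summable (\<lambda>k. (cmod (bergman_coeff h k))\<^sup>2 / (real k + 1))"
    and "(\<Sum>k. (cmod (bergman_coeff h k))\<^sup>2 / (real k + 1)) \<le> (L2_norm h)\<^sup>2"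
proof -
  have le: "(\<Sum>k<M. (cmod (bergman_coeff h k))\<^sup>2 / (real k + 1)) \<le> (L2_norm h)\<^sup>2" for M
  proof -
    have "0 \<le> (LINT z|disk_area. (cmod (h z - (\<Sum>k<M. bergman_coeff h k * z ^ k)))\<^sup>2)" by simp
    then show ?thesis unfolding integral_diff_partial_sum[OF assms] L2_norm_power2 by simp
  qed
  then show "summable (\<lambda>k. (cmod (bergman_coeff h k))\<^sup>2 / (real k + 1))"
    by (intro summableI_nonneg_bounded) auto
  then show "(\<Sum>k. (cmod (bergman_coeff h k))\<^sup>2 / (real k + 1)) \<le> (L2_norm h)\<^sup>2"
    by (rule suminf_le_const) (rule le)
qed

section \<open>Power series coefficients and the Bergman projection\<close>

definition bergman_series :: "(nat \<Rightarrow> complex) \<Rightarrow> complex \<Rightarrow> complex"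
  where "bergman_series c z = (if cmod z < 1 then (\<Sum>k. c k * z ^ k) else 0)"

abbreviation bergman_seq :: "(nat \<Rightarrow> complex) \<Rightarrow> bool"
  where "bergman_seq c \<equiv> summable (\<lambda>k. (cmod (c k))\<^sup>2 / (real k + 1))"

lemma bergman_spaceD:
  assumes "f \<in> bergman_space"
  shows "f holomorphic_on unit_disk" "cmod z \<ge> 1 \<Longrightarrow> f z = 0" "square_integrable f"
  using assms by (auto simp: bergman_space_def square_integrable_def holomorphic_measurable_disk_area)

lemma bergman_coeff_power_series:
  assumes sums: "\<And>z. cmod z < 1 \<Longrightarrow> (\<lambda>k. c k * z ^ k) sums f z" and f: "square_integrable f"
  shows "bergman_coeff f k = c k"
proof -
  have "L2_inner f (\<lambda>z. z ^ k) = c k / (of_nat k + 1)"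
    using integral_radial_power_series[OF sums square_integrable_integrable[OF f], of "\<lambda>_. 1" 1 k]
    by (simp add: L2_inner_def integral_cmod_power)
  moreover have "(of_nat k + 1 :: complex) \<noteq> 0"
    by (metis of_nat_Suc of_nat_neq_0 add.commute)
  ultimately show ?thesis by (simp add: bergman_coeff_def)
qed

lemma bergman_space_eq_series:
  assumes f: "f \<in> bergman_space"
  shows "f = bergman_series (bergman_coeff f)"
    and "cmod z < 1 \<Longrightarrow> (\<lambda>k. bergman_coeff f k * z ^ k) sums f z"
proof -
  have sums: "(\<lambda>k. ((deriv ^^ k) f 0 / fact k) * z ^ k) sums f z" if "cmod z < 1" for z
    using holomorphic_power_series[OF bergman_spaceD(1)[OF f], of z] that by simp
  have c: "bergman_coeff f k = (deriv ^^ k) f 0 / fact k" for k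
    by (rule bergman_coeff_power_series[OF sums bergman_spaceD(3)[OF f]])
  from c have *: "(\<lambda>k. bergman_coeff f k * z ^ k) sums f z" if "cmod z < 1" for z using sums[OF that] by simp
  then show "cmod z < 1 \<Longrightarrow> (\<lambda>k. bergman_coeff f k * z ^ k) sums f z" by blast
  show "f = bergman_series (bergman_coeff f)"
    using * bergman_spaceD(2)[OF f] by (auto simp: bergman_series_def fun_eq_iff sums_iff)
qed

text \<open>
  Membership in the weighted sequence space bounds \<open>c k\<close> by a multiple of \<open>k + 1\<close>, which
  suffices for convergence in the open disk.
\<close>

lemma bergman_seq_sums:
  assumes c: "bergman_seq c" and z: "cmod z < 1"
  shows "(\<lambda>k. c k * z ^ k) sums bergman_series c z"
proof -
  define K where "K = (\<Sum>k. (cmod (c k))\<^sup>2 / (real k + 1))"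
  have K0: "0 \<le> K" unfolding K_def by (rule suminf_nonneg[OF c]) simp
  have "(cmod (c k))\<^sup>2 / (real k + 1) \<le> K" for k
    unfolding K_def using sum_le_suminf[OF c, of "{k}"] by simp
  then have "(cmod (c k))\<^sup>2 \<le> K * (real k + 1)" for k
    by (simp add: divide_le_eq)
  also have "K * (real k + 1) \<le> ((K + 1) * (real k + 1))\<^sup>2" for k
  proof -
    have "K * (real k + 1) \<le> (K + 1) * (real k + 1)" using K0 by (intro mult_right_mono) auto
    also have "\<dots> \<le> ((K + 1) * (real k + 1))\<^sup>2"
      using K0 mult_mono[of 1 "K + 1" 1 "real k + 1"] by (intro self_le_power) auto
    finally show ?thesis .
  qed
  finally have "(cmod (c k))\<^sup>2 \<le> ((K + 1) * (real k + 1))\<^sup>2" for k .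
  then have le: "cmod (c k) \<le> (K + 1) * (real k + 1)" for k
    by (rule power2_le_imp_le) (use K0 in auto)
  have "summable (\<lambda>k. (K + 1) * (of_nat (Suc k) * cmod z ^ k))"
    using geometric_deriv_sums[of "cmod z"] z by (intro summable_mult sums_summable) auto
  then have "summable (\<lambda>k. c k * z ^ k)"
  proof (rule summable_comparison_test'[where N = 0])
    fix k
    show "norm (c k * z ^ k) \<le> (K + 1) * (of_nat (Suc k) * cmod z ^ k)"
      using mult_right_mono[OF le[of k], of "cmod z ^ k"] by (simp add: norm_mult norm_power algebra_simps)
  qed
  then show ?thesis using z by (simp add: bergman_series_def summable_sums)
qed

text \<open>
  The partial sums have uniformly bounded norms, so Fatou's lemma shows that the sum of the series is
  square-integrable with at most the expected norm; Bessel's inequality gives the reverse bound. Hence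
  the coefficients identify the Bergman space with a weighted sequence space.
\<close>

lemma bergman_series_in_space:
  assumes c: "bergman_seq c"
  shows "bergman_series c \<in> bergman_space"
    and "bergman_coeff (bergman_series c) = c"
    and "(L2_norm (bergman_series c))\<^sup>2 = (\<Sum>k. (cmod (c k))\<^sup>2 / (real k + 1))"
proof -
  define f where "f = bergman_series c"
  define K where "K = (\<Sum>k. (cmod (c k))\<^sup>2 / (real k + 1))"
  define S where "S M z = (\<Sum>k<M. c k * z ^ k)" for M z
  have sums: "(\<lambda>k. c k * z ^ k) sums f z" if "cmod z < 1" for z
    using bergman_seq_sums[OF c that] by (simp add: f_def)
  have hol: "f holomorphic_on unit_disk"
    using sums by (intro power_series_holomorphic[of 0 1 c f]) auto
  then have [measurable]: "f \<in> borel_measurable disk_area" by (rule holomorphic_measurable_disk_area)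
  have [measurable]: "S M \<in> borel_measurable disk_area" for M unfolding S_def[abs_def] by simp
  have K0: "0 \<le> K" unfolding K_def by (rule suminf_nonneg[OF c]) simp
  have S: "square_integrable (S M)" for M unfolding S_def
    by (intro square_integrable_sum square_integrable_mult_const square_integrable_power)
  have SM: "(LINT z|disk_area. (cmod (S M z))\<^sup>2) \<le> K" for M
  proof -
    have sM: "(\<lambda>k. (if k < M then c k else 0) * z ^ k) sums S M z" for z
      using sums_If_finite_set[of "{..<M}" "\<lambda>k. c k * z ^ k"]
      by (simp add: S_def if_distrib[of "\<lambda>x. x * _"] cong: if_cong)
    have cS: "bergman_coeff (S M) k = (if k < M then c k else 0)" for k
      by (rule bergman_coeff_power_series[OF sM S])
    have "(LINT z|disk_area. (cmod (S M z - (\<Sum>k<M. bergman_coeff (S M) k * z ^ k)))\<^sup>2) = 0"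
      by (simp add: cS S_def)
    then have "(LINT z|disk_area. (cmod (S M z))\<^sup>2) = (\<Sum>k<M. (cmod (c k))\<^sup>2 / (real k + 1))"
      using integral_diff_partial_sum[OF S[of M], of M] by (simp add: cS)
    also have "\<dots> \<le> K" unfolding K_def by (rule sum_le_suminf[OF c]) auto
    finally show ?thesis .
  qed
  have "(\<integral>\<^sup>+z. ennreal ((cmod (f z))\<^sup>2) \<partial>disk_area) = (\<integral>\<^sup>+z. liminf (\<lambda>M. ennreal ((cmod (S M z))\<^sup>2)) \<partial>disk_area)"
  proof (rule nn_integral_cong)
    fix z assume "z \<in> space disk_area"
    then have "(\<lambda>M. S M z) \<longlonglongrightarrow> f z" using sums by (simp add: sums_def S_def)
    then have "(\<lambda>M. ennreal ((cmod (S M z))\<^sup>2)) \<longlonglongrightarrow> ennreal ((cmod (f z))\<^sup>2)"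
      by (intro tendsto_intros)
    then show "ennreal ((cmod (f z))\<^sup>2) = liminf (\<lambda>M. ennreal ((cmod (S M z))\<^sup>2))"
      by (rule lim_imp_Liminf[OF sequentially_bot, symmetric])
  qed
  also have "\<dots> \<le> liminf (\<lambda>M. \<integral>\<^sup>+z. ennreal ((cmod (S M z))\<^sup>2) \<partial>disk_area)"
    by (rule nn_integral_liminf) measurable
  also have "\<dots> \<le> ennreal K"
  proof -
    have "(\<integral>\<^sup>+z. ennreal ((cmod (S M z))\<^sup>2) \<partial>disk_area) \<le> ennreal K" for M
      using S[of M] SM[of M] by (subst nn_integral_eq_integral) (auto simp: square_integrable_def ennreal_leI)
    then show ?thesis by (intro Liminf_le) auto
  qed
  finally have fK: "(\<integral>\<^sup>+z. ennreal ((cmod (f z))\<^sup>2) \<partial>disk_area) \<le> ennreal K" .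
  then have int: "integrable disk_area (\<lambda>z. (cmod (f z))\<^sup>2)"
    by (intro integrableI_bounded) (auto simp: less_top[symmetric] top_unique intro: le_less_trans)
  then show fb: "bergman_series c \<in> bergman_space"
    using hol by (auto simp: bergman_space_def f_def bergman_series_def)
  have sq: "square_integrable f" using int by (simp add: square_integrable_def)
  have cf: "bergman_coeff f k = c k" for k by (rule bergman_coeff_power_series[OF sums sq])
  then show "bergman_coeff (bergman_series c) = c" by (auto simp: f_def)
  have "(L2_norm f)\<^sup>2 \<le> K"
    using fK K0 unfolding L2_norm_power2
    by (subst (asm) nn_integral_eq_integral[OF int]) auto
  moreover have "K \<le> (L2_norm f)\<^sup>2"
    using Bessel_inequality(2)[OF sq] by (simp add: cf K_def)
  ultimately show "(L2_norm (bergman_series c))\<^sup>2 = (\<Sum>k. (cmod (c k))\<^sup>2 / (real k + 1))"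
    by (simp add: f_def K_def)
qed

lemma Parseval_bergman:
  assumes f: "f \<in> bergman_space"
  shows "(L2_norm f)\<^sup>2 = (\<Sum>k. (cmod (bergman_coeff f k))\<^sup>2 / (real k + 1))"
  using bergman_series_in_space(3)[OF Bessel_inequality(1)[OF bergman_spaceD(3)[OF f]]]
    bergman_space_eq_series(1)[OF f] by simp

text \<open>
  Polynomials are dense: by Parseval's identity the partial sums of \<open>g\<close> converge to \<open>g\<close> in norm, and
  \<open>h\<close> is orthogonal to each of them.
\<close>

lemma orthogonal_bergman_space:
  assumes h: "square_integrable h" "\<And>k. bergman_coeff h k = 0" and g: "g \<in> bergman_space"
  shows "L2_inner h g = 0"
proof -
  note gs = bergman_spaceD(3)[OF g]
  define S where "S M z = (\<Sum>k<M. bergman_coeff g k * z ^ k)" for M z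
  have S: "square_integrable (S M)" for M unfolding S_def
    by (intro square_integrable_sum square_integrable_mult_const square_integrable_power)
  have "L2_inner h (S M) = 0" for M
    unfolding S_def using h
    by (subst L2_inner_sum_right) (auto simp: square_integrable_power L2_inner_power)
  then have "L2_inner h g = L2_inner h (\<lambda>z. g z - S M z)" for M
    using h gs S by (simp add: L2_inner_diff_right)
  then have le: "cmod (L2_inner h g) \<le> L2_norm h * L2_norm (\<lambda>z. g z - S M z)" for M
    using Cauchy_Schwarz_L2_inner[OF h(1) square_integrable_diff[OF gs S]] by metis
  have "(\<lambda>M. (L2_norm g)\<^sup>2 - (\<Sum>k<M. (cmod (bergman_coeff g k))\<^sup>2 / (real k + 1))) \<longlonglongrightarrow> (L2_norm g)\<^sup>2 - (L2_norm g)\<^sup>2"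
    unfolding Parseval_bergman[OF g]
    by (intro tendsto_intros summable_LIMSEQ Bessel_inequality(1) gs)
  then have "(\<lambda>M. (L2_norm (\<lambda>z. g z - S M z))\<^sup>2) \<longlonglongrightarrow> 0"
    unfolding L2_norm_power2 S_def integral_diff_partial_sum[OF gs] by simp
  from tendsto_real_sqrt[OF this] have "(\<lambda>M. L2_norm (\<lambda>z. g z - S M z)) \<longlonglongrightarrow> 0"
    by (simp add: L2_norm_def)
  then have "(\<lambda>M. L2_norm h * L2_norm (\<lambda>z. g z - S M z)) \<longlonglongrightarrow> L2_norm h * 0"
    by (intro tendsto_intros)
  then have "cmod (L2_inner h g) \<le> L2_norm h * 0"
    by (rule LIMSEQ_le_const) (use le in auto)
  then show ?thesis by simp
qed

text \<open>
  Only the representative that vanishes off the disk is an element of the Bergman space.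
\<close>

definition bergman_power :: "nat \<Rightarrow> complex \<Rightarrow> complex"
  where "bergman_power k z = (if cmod z < 1 then z ^ k else 0)"

lemma bergman_power_in_space: "bergman_power k \<in> bergman_space"
proof -
  have "bergman_power k holomorphic_on unit_disk"
    by (rule holomorphic_transform[of "\<lambda>z. z ^ k"]) (auto simp: bergman_power_def intro!: holomorphic_intros)
  moreover have "integrable disk_area (\<lambda>z. (cmod (bergman_power k z))\<^sup>2) \<longleftrightarrow> integrable disk_area (\<lambda>z. (cmod (z ^ k))\<^sup>2)"
    by (intro Bochner_Integration.integrable_cong refl) (auto simp: bergman_power_def)
  ultimately show ?thesis
    using square_integrable_power[of k] by (auto simp: bergman_space_def square_integrable_def bergman_power_def)
qed

lemma L2_inner_bergman_power: "L2_inner h (bergman_power k) = L2_inner h (\<lambda>z. z ^ k)"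
  by (rule L2_inner_cong) (auto simp: bergman_power_def)

lemma bergman_coeff_diff:
  assumes "square_integrable f" "square_integrable g"
  shows "bergman_coeff (\<lambda>z. f z - g z) k = bergman_coeff f k - bergman_coeff g k"
  using assms by (simp add: bergman_coeff_def L2_inner_diff_left square_integrable_power algebra_simps)

lemma bergman_space_eqI:
  assumes "f \<in> bergman_space" "g \<in> bergman_space" "\<And>k. bergman_coeff f k = bergman_coeff g k"
  shows "f = g"
  using assms(1,2)[THEN bergman_space_eq_series(1)] assms(3) by (metis ext)

text \<open>
  By Bessel's inequality the coefficients of \<open>h\<close> are those of an element of the Bergman space, and
  \<open>h\<close> minus this element has vanishing coefficients. Testing against monomials shows that no other
  element works, so the definite description in the definition of the projection is met.
\<close>

lemma bergman_projection_props:
  assumes h: "square_integrable h"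
  shows "bergman_projection h \<in> bergman_space"
    and "bergman_coeff (bergman_projection h) = bergman_coeff h"
    and "L2_norm (bergman_projection h) \<le> L2_norm h"
    and "g \<in> bergman_space \<Longrightarrow> L2_inner (bergman_projection h) g = L2_inner h g"
proof -
  define p where "p = bergman_series (bergman_coeff h)"
  note hc = Bessel_inequality(1)[OF h]
  note pb = bergman_series_in_space(1)[OF hc, folded p_def]
  note pc = bergman_series_in_space(2)[OF hc, folded p_def]
  note ps = bergman_spaceD(3)[OF pb]
  have orth: "L2_inner (\<lambda>z. h z - p z) k = 0" if "k \<in> bergman_space" for k
    by (rule orthogonal_bergman_space[OF square_integrable_diff[OF h ps] _ that])
       (simp add: bergman_coeff_diff h ps pc)
  have eq: "bergman_projection h = p"
    unfolding bergman_projection_def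
  proof (rule the_equality)
    fix g assume g: "g \<in> bergman_space \<and> (\<forall>k\<in>bergman_space. L2_inner (\<lambda>z. h z - g z) k = 0)"
    have "bergman_coeff (\<lambda>z. h z - g z) k = 0" for k
      using g bergman_power_in_space[of k] by (simp add: bergman_coeff_def L2_inner_bergman_power[symmetric])
    then have "bergman_coeff g k = bergman_coeff p k" for k
      using bergman_coeff_diff[OF h bergman_spaceD(3), of g k] g by (simp add: pc)
    then show "g = p" using g pb by (intro bergman_space_eqI) auto
  qed (use pb orth in auto)
  show "bergman_projection h \<in> bergman_space" "bergman_coeff (bergman_projection h) = bergman_coeff h"
    using eq pb pc by auto
  have "(L2_norm p)\<^sup>2 \<le> (L2_norm h)\<^sup>2"
    using bergman_series_in_space(3)[OF hc] Bessel_inequality(2)[OF h] by (simp add: p_def)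
  then show "L2_norm (bergman_projection h) \<le> L2_norm h"
    unfolding eq by (rule power2_le_imp_le) (simp add: L2_norm_def)
  show "L2_inner (bergman_projection h) g = L2_inner h g" if "g \<in> bergman_space"
    using orth[OF that] L2_inner_diff_left[OF h ps bergman_spaceD(3)[OF that]] eq by simp
qed

section \<open>Toeplitz operators with bounded symbols\<close>

definition bounded_symbol :: "(complex \<Rightarrow> complex) \<Rightarrow> bool"
  where "bounded_symbol \<phi> \<longleftrightarrow> \<phi> \<in> borel_measurable disk_area \<and> (\<exists>B. \<forall>z. cmod z < 1 \<longrightarrow> cmod (\<phi> z) \<le> B)"

lemma bounded_symbol_cnj: "bounded_symbol \<phi> \<Longrightarrow> bounded_symbol (\<lambda>z. cnj (\<phi> z))"
  unfolding bounded_symbol_def by auto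

lemma square_integrable_symbol_mult:
  assumes "bounded_symbol \<phi>" "f \<in> bergman_space"
  shows "square_integrable (\<lambda>z. \<phi> z * f z)"
  using assms square_integrable_bounded_mult(1)[OF bergman_spaceD(3)[OF assms(2)]]
  by (auto simp: bounded_symbol_def)

lemma toeplitz_in_space:
  assumes "bounded_symbol \<phi>" "f \<in> bergman_space"
  shows "toeplitz \<phi> f \<in> bergman_space" and "bergman_coeff (toeplitz \<phi> f) = bergman_coeff (\<lambda>z. \<phi> z * f z)"
  using bergman_projection_props(1,2)[OF square_integrable_symbol_mult[OF assms]]
  by (auto simp: toeplitz_def)

lemma bergman_space_add:
  assumes "f \<in> bergman_space" "g \<in> bergman_space"
  shows "(\<lambda>z. f z + g z) \<in> bergman_space"
  using assms square_integrable_add[OF assms[THEN bergman_spaceD(3)]]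
  by (auto simp: bergman_space_def square_integrable_def intro!: holomorphic_intros)

lemma bergman_space_mult_const:
  assumes "f \<in> bergman_space"
  shows "(\<lambda>z. c * f z) \<in> bergman_space"
  using assms square_integrable_mult_const[OF bergman_spaceD(3)[OF assms], of c]
  by (auto simp: bergman_space_def square_integrable_def intro!: holomorphic_intros)

lemma bergman_coeff_add:
  assumes "square_integrable f" "square_integrable g"
  shows "bergman_coeff (\<lambda>z. f z + g z) k = bergman_coeff f k + bergman_coeff g k"
  using assms by (simp add: bergman_coeff_def L2_inner_add_left square_integrable_power algebra_simps)

lemma bergman_coeff_mult_const: "bergman_coeff (\<lambda>z. c * f z) k = c * bergman_coeff f k"
  by (simp add: bergman_coeff_def L2_inner_mult_left)

lemma bounded_operator_toeplitz:
  assumes \<phi>: "bounded_symbol \<phi>"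
  shows "bounded_operator (toeplitz \<phi>)"
  unfolding bounded_operator_def
proof (intro conjI ballI allI)
  show "toeplitz \<phi> f \<in> bergman_space" if "f \<in> bergman_space" for f
    by (rule toeplitz_in_space[OF \<phi> that])
  show "toeplitz \<phi> (\<lambda>z. f z + g z) = (\<lambda>z. toeplitz \<phi> f z + toeplitz \<phi> g z)"
    if f: "f \<in> bergman_space" and g: "g \<in> bergman_space" for f g
  proof (rule bergman_space_eqI)
    show "toeplitz \<phi> (\<lambda>z. f z + g z) \<in> bergman_space" "(\<lambda>z. toeplitz \<phi> f z + toeplitz \<phi> g z) \<in> bergman_space"
      by (intro toeplitz_in_space bergman_space_add \<phi> f g)+
    show "bergman_coeff (toeplitz \<phi> (\<lambda>z. f z + g z)) k = bergman_coeff (\<lambda>z. toeplitz \<phi> f z + toeplitz \<phi> g z) k" for k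
      using bergman_coeff_add[OF square_integrable_symbol_mult[OF \<phi> f] square_integrable_symbol_mult[OF \<phi> g]]
      by (simp add: toeplitz_in_space bergman_space_add \<phi> f g bergman_coeff_add bergman_spaceD(3) ring_distribs)
  qed
  show "toeplitz \<phi> (\<lambda>z. c * f z) = (\<lambda>z. c * toeplitz \<phi> f z)" if f: "f \<in> bergman_space" for c f
  proof (rule bergman_space_eqI)
    show "toeplitz \<phi> (\<lambda>z. c * f z) \<in> bergman_space" "(\<lambda>z. c * toeplitz \<phi> f z) \<in> bergman_space"
      by (intro toeplitz_in_space bergman_space_mult_const \<phi> f)+
    show "bergman_coeff (toeplitz \<phi> (\<lambda>z. c * f z)) k = bergman_coeff (\<lambda>z. c * toeplitz \<phi> f z) k" for k
      using bergman_coeff_mult_const[of c "\<lambda>z. \<phi> z * f z" k]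
      by (simp add: toeplitz_in_space bergman_space_mult_const \<phi> f bergman_coeff_mult_const mult.left_commute)
  qed
  obtain B where B: "\<And>z. cmod z < 1 \<Longrightarrow> cmod (\<phi> z) \<le> B" and m: "\<phi> \<in> borel_measurable disk_area"
    using \<phi> by (auto simp: bounded_symbol_def)
  have "L2_norm (toeplitz \<phi> f) \<le> B * L2_norm f" if f: "f \<in> bergman_space" for f
    using bergman_projection_props(3)[OF square_integrable_symbol_mult[OF \<phi> f]]
      square_integrable_bounded_mult(2)[OF bergman_spaceD(3)[OF f] m B]
    by (simp add: toeplitz_def)
  then show "\<exists>C. \<forall>f\<in>bergman_space. L2_norm (toeplitz \<phi> f) \<le> C * L2_norm f" by blast
qed

lemma L2_inner_toeplitz:
  assumes "bounded_symbol \<phi>" "f \<in> bergman_space" "g \<in> bergman_space"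
  shows "L2_inner (toeplitz \<phi> f) g = L2_inner f (toeplitz (\<lambda>z. cnj (\<phi> z)) g)"
proof -
  have "L2_inner (toeplitz \<phi> f) g = L2_inner (\<lambda>z. \<phi> z * f z) g"
    unfolding toeplitz_def using assms by (intro bergman_projection_props(4) square_integrable_symbol_mult)
  also have "\<dots> = cnj (L2_inner (\<lambda>z. cnj (\<phi> z) * g z) f)"
    by (subst L2_inner_commute[symmetric]) (simp add: L2_inner_def mult_ac)
  also have "L2_inner (\<lambda>z. cnj (\<phi> z) * g z) f = L2_inner (toeplitz (\<lambda>z. cnj (\<phi> z)) g) f"
    unfolding toeplitz_def using assms
    by (intro bergman_projection_props(4)[symmetric] square_integrable_symbol_mult bounded_symbol_cnj)
  also have "cnj \<dots> = L2_inner f (toeplitz (\<lambda>z. cnj (\<phi> z)) g)"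
    by (rule L2_inner_commute[symmetric])
  finally show ?thesis .
qed

lemma adjoint_toeplitz:
  assumes \<phi>: "bounded_symbol \<phi>" and g: "g \<in> bergman_space"
  shows "adjoint_operator (toeplitz \<phi>) g = toeplitz (\<lambda>z. cnj (\<phi> z)) g"
  unfolding adjoint_operator_def
proof (rule the_equality)
  let ?t = "toeplitz (\<lambda>z. cnj (\<phi> z)) g"
  have t: "?t \<in> bergman_space" by (intro toeplitz_in_space bounded_symbol_cnj \<phi> g)
  show "?t \<in> bergman_space \<and> (\<forall>f\<in>bergman_space. L2_inner (toeplitz \<phi> f) g = L2_inner f ?t)"
    using t L2_inner_toeplitz \<phi> g by blast
  fix h assume h: "h \<in> bergman_space \<and> (\<forall>f\<in>bergman_space. L2_inner (toeplitz \<phi> f) g = L2_inner f h)"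
  have "L2_inner (bergman_power k) h = L2_inner (bergman_power k) ?t" for k
    using h L2_inner_toeplitz[OF \<phi> bergman_power_in_space g] bergman_power_in_space by metis
  then have "L2_inner h (bergman_power k) = L2_inner ?t (bergman_power k)" for k
    by (metis L2_inner_commute)
  then have "bergman_coeff h k = bergman_coeff ?t k" for k
    by (simp add: bergman_coeff_def L2_inner_bergman_power)
  then show "h = ?t" using h t by (intro bergman_space_eqI) auto
qed

text \<open>
  The self-commutator form is \<open>\<parallel>T f\<parallel>\<^sup>2 - \<parallel>T\<^sup>* f\<parallel>\<^sup>2\<close>, and both norms are given by Parseval's
  identity because projecting does not change coefficients.
\<close>

lemma self_commutator_toeplitz:
  assumes \<phi>: "bounded_symbol \<phi>" and f: "f \<in> bergman_space"
  shows "L2_inner (self_commutator (toeplitz \<phi>) f) f =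
    of_real ((\<Sum>k. (cmod (bergman_coeff (\<lambda>z. \<phi> z * f z) k))\<^sup>2 / (real k + 1)) -
             (\<Sum>k. (cmod (bergman_coeff (\<lambda>z. cnj (\<phi> z) * f z) k))\<^sup>2 / (real k + 1)))"
proof -
  define T where "T = toeplitz \<phi>"
  define A where "A = toeplitz (\<lambda>z. cnj (\<phi> z))"
  note \<phi>' = bounded_symbol_cnj[OF \<phi>]
  have Tf: "T f \<in> bergman_space" and Af: "A f \<in> bergman_space"
    unfolding T_def A_def by (intro toeplitz_in_space \<phi> \<phi>' f)+
  have sq: "square_integrable (A (T f))" "square_integrable (T (A f))" "square_integrable f"
    using toeplitz_in_space(1)[OF \<phi>' Tf] toeplitz_in_space(1)[OF \<phi> Af] f
    by (auto simp: A_def[symmetric] T_def[symmetric] bergman_spaceD(3))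
  have "self_commutator T f = (\<lambda>z. A (T f) z - T (A f) z)"
    using adjoint_toeplitz[OF \<phi>] f Tf by (simp add: self_commutator_def T_def A_def)
  then have "L2_inner (self_commutator T f) f = L2_inner (A (T f)) f - L2_inner (T (A f)) f"
    using sq by (simp add: L2_inner_diff_left)
  also have "L2_inner (T (A f)) f = L2_inner (A f) (A f)"
    using L2_inner_toeplitz[OF \<phi> Af f] by (simp add: T_def A_def)
  also have "L2_inner (A (T f)) f = L2_inner (T f) (T f)"
    using L2_inner_toeplitz[OF \<phi>' Tf f] by (simp add: T_def A_def)
  finally have "L2_inner (self_commutator T f) f = of_real ((L2_norm (T f))\<^sup>2 - (L2_norm (A f))\<^sup>2)"
    by (simp add: L2_inner_self L2_norm_power2)
  then show ?thesis
    unfolding Parseval_bergman[OF Tf] Parseval_bergman[OF Af]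
    using toeplitz_in_space(2)[OF \<phi> f] toeplitz_in_space(2)[OF \<phi>' f] by (simp add: T_def A_def)
qed

lemma hyponormal_toeplitz_iff:
  assumes \<phi>: "bounded_symbol \<phi>"
  shows "hyponormal (toeplitz \<phi>) \<longleftrightarrow>
    (\<forall>f\<in>bergman_space. (\<Sum>k. (cmod (bergman_coeff (\<lambda>z. cnj (\<phi> z) * f z) k))\<^sup>2 / (real k + 1)) \<le>
                       (\<Sum>k. (cmod (bergman_coeff (\<lambda>z. \<phi> z * f z) k))\<^sup>2 / (real k + 1)))"
  unfolding hyponormal_def
  by (simp add: bounded_operator_toeplitz self_commutator_toeplitz \<phi> complex_nonneg_Reals_iff)

lemma bergman_coeff_raise:
  assumes f: "f \<in> bergman_space" and x: "x > 0"
  shows "bergman_coeff (\<lambda>z. z ^ n * of_real (cmod z powr (2 * x)) * f z) k =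
    (if n \<le> k then (of_nat k + 1) * bergman_coeff f (k - n) / of_real (real k + x + 1) else 0)"
proof -
  define g where "g z = z ^ n * f z" for z
  define c where "c k = (if n \<le> k then bergman_coeff f (k - n) else 0)" for k
  have sums: "(\<lambda>k. c k * z ^ k) sums g z" if z: "cmod z < 1" for z
  proof -
    have "(\<lambda>k. z ^ n * (bergman_coeff f k * z ^ k)) sums g z"
      unfolding g_def by (intro sums_mult bergman_space_eq_series(2) f z)
    then have "(\<lambda>k. c (k + n) * z ^ (k + n)) sums g z"
      by (simp add: c_def power_add mult_ac)
    then show ?thesis
      by (subst (asm) sums_iff_shift) (simp add: c_def)
  qed
  have g: "square_integrable g" unfolding g_def
    by (rule square_integrable_bounded_mult[OF bergman_spaceD(3)[OF f], where B = 1])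
       (auto simp: norm_power power_le_one)
  have "L2_inner (\<lambda>z. z ^ n * of_real (cmod z powr (2 * x)) * f z) (\<lambda>z. z ^ k)
     = (LINT z|disk_area. of_real (cmod z powr (2 * x)) * g z * cnj z ^ k)"
    by (simp add: L2_inner_def g_def mult_ac)
  also have "\<dots> = c k * of_real (LINT z|disk_area. cmod z powr (2 * x) * cmod z ^ (2 * k))"
    by (rule integral_radial_power_series[OF sums square_integrable_integrable[OF g], where B = 1])
       (use x in \<open>auto simp: powr_le1\<close>)
  finally show ?thesis using x by (simp add: bergman_coeff_def integral_cmod_powr_power c_def)
qed

lemma bergman_coeff_lower:
  assumes f: "f \<in> bergman_space" and x: "x > 0"
  shows "bergman_coeff (\<lambda>z. cnj z ^ m * of_real (cmod z powr (2 * x)) * f z) k =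
    (of_nat k + 1) * bergman_coeff f (k + m) / of_real (real (k + m) + x + 1)"
proof -
  have "L2_inner (\<lambda>z. cnj z ^ m * of_real (cmod z powr (2 * x)) * f z) (\<lambda>z. z ^ k)
     = (LINT z|disk_area. of_real (cmod z powr (2 * x)) * f z * cnj z ^ (k + m))"
    by (simp add: L2_inner_def power_add mult_ac)
  also have "\<dots> = bergman_coeff f (k + m) * of_real (LINT z|disk_area. cmod z powr (2 * x) * cmod z ^ (2 * (k + m)))"
    by (rule integral_radial_power_series[OF bergman_space_eq_series(2)[OF f] square_integrable_integrable[OF bergman_spaceD(3)[OF f]], where B = 1])
       (use x in \<open>auto simp: powr_le1\<close>)
  finally show ?thesis
    unfolding integral_cmod_powr_power[OF x] by (subst bergman_coeff_def) simp
qed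

section \<open>The self-commutator as a quadratic form\<close>

text \<open>
  The action of \<open>z ^ n * |z| powr (2 * s)\<close> on coefficients, up to the factor \<open>k + 1\<close>; see
  \<open>bergman_coeff_raise\<close>.
\<close>

definition shift_up :: "nat \<Rightarrow> real \<Rightarrow> (nat \<Rightarrow> complex) \<Rightarrow> nat \<Rightarrow> complex"
  where "shift_up n s x k = (if n \<le> k then x (k - n) / of_real (real k + s + 1) else 0)"

text \<open>
  The action of the conjugate symbol, up to the same factor; see \<open>bergman_coeff_lower\<close>.
\<close>

definition shift_down :: "nat \<Rightarrow> real \<Rightarrow> (nat \<Rightarrow> complex) \<Rightarrow> nat \<Rightarrow> complex"
  where "shift_down n s x k = x (k + n) / of_real (real (k + n) + s + 1)"

text \<open>
  The diagonal entries of the self-commutator of the Toeplitz operator with symbol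
  \<open>z ^ n * |z| powr (2 * s)\<close>, with respect to the monomials.
\<close>

definition diagonal_weight :: "nat \<Rightarrow> real \<Rightarrow> nat \<Rightarrow> real"
  where "diagonal_weight n s i = (real i + n + 1) / (real i + n + s + 1)\<^sup>2 -
                      (if n \<le> i then (real i - n + 1) / (real i + s + 1)\<^sup>2 else 0)"

text \<open>
  The entries, at distance \<open>n + m\<close> from the diagonal, of the mixed commutator of the operators with
  symbols \<open>z ^ n * |z| powr (2 * s)\<close> and \<open>cnj z ^ m * |z| powr (2 * t)\<close>.
\<close>

definition cross_weight :: "nat \<Rightarrow> real \<Rightarrow> nat \<Rightarrow> real \<Rightarrow> nat \<Rightarrow> real"
  where "cross_weight n s m t i =
    (real i + n + 1) / ((real i + n + s + 1) * (real i + n + m + t + 1)) -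
    (real i + m + 1) / ((real i + m + t + 1) * (real i + m + n + s + 1))"

lemma suminf_shift_zero:
  fixes u :: "nat \<Rightarrow> 'a :: real_normed_vector"
  assumes "\<And>k. k < n \<Longrightarrow> u k = 0" "summable (\<lambda>i. u (i + n))"
  shows "summable u" "(\<Sum>k. u k) = (\<Sum>i. u (i + n))"
proof -
  have "u sums (\<Sum>i. u (i + n))"
    using summable_sums[OF assms(2)] assms(1) by (subst (asm) sums_iff_shift) simp
  then show "summable u" "(\<Sum>k. u k) = (\<Sum>i. u (i + n))" by (auto simp: sums_iff)
qed

lemma shift_up_sums:
  assumes x: "bergman_seq x" and s: "s > 0"
  shows "summable (\<lambda>i. (real i + n + 1) / (real i + n + s + 1)\<^sup>2 * (cmod (x i))\<^sup>2)"
    and "summable (\<lambda>k. (real k + 1) * (cmod (shift_up n s x k))\<^sup>2)"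
    and "(\<Sum>k. (real k + 1) * (cmod (shift_up n s x k))\<^sup>2) =
         (\<Sum>i. (real i + n + 1) / (real i + n + s + 1)\<^sup>2 * (cmod (x i))\<^sup>2)"
proof -
  define u where "u k = (real k + 1) * (cmod (shift_up n s x k))\<^sup>2" for k
  define v where "v i = (real i + n + 1) / (real i + n + s + 1)\<^sup>2 * (cmod (x i))\<^sup>2" for i
  have uv: "u (i + n) = v i" for i
  proof -
    have "cmod (shift_up n s x (i + n)) = cmod (x i) / (real i + n + s + 1)"
      using s by (simp add: shift_up_def norm_divide del: of_real_add)
    then show ?thesis by (simp add: u_def v_def power_divide add_ac)
  qed
  have v: "summable v"
  proof (rule summable_comparison_test'[where N = 0, OF x])
    fix i
    have "(real i + n + 1) * (real i + 1) \<le> (real i + n + s + 1) * (real i + n + s + 1)"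
      using s by (intro mult_mono) auto
    then have "(real i + n + 1) / (real i + n + s + 1)\<^sup>2 \<le> 1 / (real i + 1)"
      using s by (simp add: divide_simps power2_eq_square add_pos_nonneg)
    then have "v i \<le> 1 / (real i + 1) * (cmod (x i))\<^sup>2"
      unfolding v_def by (rule mult_right_mono) simp
    then show "norm (v i) \<le> (cmod (x i))\<^sup>2 / (real i + 1)" by (simp add: v_def)
  qed
  then show "summable (\<lambda>i. (real i + n + 1) / (real i + n + s + 1)\<^sup>2 * (cmod (x i))\<^sup>2)"
    unfolding v_def[abs_def] .
  have zero: "u k = 0" if "k < n" for k using that by (simp add: u_def shift_up_def)
  have su: "summable u" "suminf u = suminf v"
    using suminf_shift_zero[of n u, OF zero] v by (simp_all add: uv)
  show "summable (\<lambda>k. (real k + 1) * (cmod (shift_up n s x k))\<^sup>2)"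
    using su(1) unfolding u_def[abs_def] .
  show "(\<Sum>k. (real k + 1) * (cmod (shift_up n s x k))\<^sup>2) =
         (\<Sum>i. (real i + n + 1) / (real i + n + s + 1)\<^sup>2 * (cmod (x i))\<^sup>2)"
    using su(2) unfolding u_def[abs_def] v_def[abs_def] .
qed

lemma shift_down_sums:
  assumes x: "bergman_seq x" and s: "s > 0"
  shows "summable (\<lambda>i. (if n \<le> i then (real i - n + 1) / (real i + s + 1)\<^sup>2 else 0) * (cmod (x i))\<^sup>2)"
    and "summable (\<lambda>k. (real k + 1) * (cmod (shift_down n s x k))\<^sup>2)"
    and "(\<Sum>k. (real k + 1) * (cmod (shift_down n s x k))\<^sup>2) =
         (\<Sum>i. (if n \<le> i then (real i - n + 1) / (real i + s + 1)\<^sup>2 else 0) * (cmod (x i))\<^sup>2)"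
proof -
  define u where "u k = (real k + 1) * (cmod (shift_down n s x k))\<^sup>2" for k
  define v where "v i = (if n \<le> i then (real i - n + 1) / (real i + s + 1)\<^sup>2 else 0) * (cmod (x i))\<^sup>2" for i
  have uv: "v (k + n) = u k" for k
  proof -
    have "cmod (shift_down n s x k) = cmod (x (k + n)) / (real k + n + s + 1)"
      using s by (simp add: shift_down_def norm_divide del: of_real_add)
    then show ?thesis by (simp add: u_def v_def power_divide add_ac)
  qed
  have v: "summable v"
  proof (rule summable_comparison_test'[where N = 0, OF x])
    fix i
    have "(if n \<le> i then (real i - n + 1) / (real i + s + 1)\<^sup>2 else 0) \<le> 1 / (real i + 1)"
    proof (cases "n \<le> i")
      case True
      then have "(real i - n + 1) * (real i + 1) \<le> (real i + s + 1) * (real i + s + 1)"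
        using s by (intro mult_mono) auto
      then show ?thesis using True s by (simp add: divide_simps power2_eq_square add_pos_nonneg)
    qed simp
    then have "v i \<le> 1 / (real i + 1) * (cmod (x i))\<^sup>2"
      unfolding v_def by (rule mult_right_mono) simp
    moreover have "0 \<le> v i" by (simp add: v_def)
    ultimately show "norm (v i) \<le> (cmod (x i))\<^sup>2 / (real i + 1)" by simp
  qed
  then show "summable (\<lambda>i. (if n \<le> i then (real i - n + 1) / (real i + s + 1)\<^sup>2 else 0) * (cmod (x i))\<^sup>2)"
    unfolding v_def[abs_def] .
  have zero: "v k = 0" if "k < n" for k using that by (simp add: v_def)
  have su: "summable u" "suminf u = suminf v"
    using suminf_shift_zero(2)[of n v, OF zero] v summable_iff_shift[of v n] by (simp_all add: uv)
  show "summable (\<lambda>k. (real k + 1) * (cmod (shift_down n s x k))\<^sup>2)"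
    using su(1) unfolding u_def[abs_def] .
  show "(\<Sum>k. (real k + 1) * (cmod (shift_down n s x k))\<^sup>2) =
         (\<Sum>i. (if n \<le> i then (real i - n + 1) / (real i + s + 1)\<^sup>2 else 0) * (cmod (x i))\<^sup>2)"
    using su(2) unfolding u_def[abs_def] v_def[abs_def] .
qed

lemma two_Re_mult_le: "\<bar>2 * Re (u * cnj v)\<bar> \<le> (cmod u)\<^sup>2 + (cmod v)\<^sup>2"
proof -
  have "\<bar>Re (u * cnj v)\<bar> \<le> cmod u * cmod v"
    using abs_Re_le_cmod[of "u * cnj v"] by (simp add: norm_mult)
  then show ?thesis using sum_squares_bound[of "cmod u" "cmod v"] by linarith
qed

text \<open>
  The mixed terms are dominated by the sum of the two square terms, which gives convergence; the
  series are then equal after a shift of the index by \<open>n\<close>.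
\<close>

lemma shift_cross_sums:
  fixes n m :: nat
  assumes x: "bergman_seq x" and s: "s > 0" and t: "t > 0"
  defines "c \<equiv> \<lambda>i. (real i + n + 1) / ((real i + n + s + 1) * (real i + n + m + t + 1))"
  shows "summable (\<lambda>i. c i * (2 * Re (x i * cnj (a * x (i + n + m)))))"
    and "summable (\<lambda>k. (real k + 1) * (2 * Re (shift_up n s x k * cnj (a * shift_down m t x k))))"
    and "(\<Sum>k. (real k + 1) * (2 * Re (shift_up n s x k * cnj (a * shift_down m t x k)))) =
         (\<Sum>i. c i * (2 * Re (x i * cnj (a * x (i + n + m)))))"
proof -
  define u where "u k = (real k + 1) * (2 * Re (shift_up n s x k * cnj (a * shift_down m t x k)))" for k
  define v where "v i = c i * (2 * Re (x i * cnj (a * x (i + n + m))))" for i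
  have uv: "u (i + n) = v i" for i
  proof -
    have "shift_up n s x (i + n) * cnj (a * shift_down m t x (i + n))
      = x i * cnj (a * x (i + n + m)) / of_real ((real i + n + s + 1) * (real i + n + m + t + 1))"
      by (simp add: shift_up_def shift_down_def add.assoc del: of_real_add)
    then show ?thesis
      unfolding u_def v_def c_def by (simp only: Re_divide_of_real) simp
  qed
  have u: "summable u"
  proof (rule summable_comparison_test'[where N = 0])
    show "summable (\<lambda>k. (real k + 1) * (cmod (shift_up n s x k))\<^sup>2 + (cmod a)\<^sup>2 * ((real k + 1) * (cmod (shift_down m t x k))\<^sup>2))"
      by (intro summable_add summable_mult shift_up_sums shift_down_sums x s t)
    fix k
    have "(real k + 1) * \<bar>2 * Re (shift_up n s x k * cnj (a * shift_down m t x k))\<bar> \<le>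
        (real k + 1) * ((cmod (shift_up n s x k))\<^sup>2 + (cmod (a * shift_down m t x k))\<^sup>2)"
      by (intro mult_left_mono two_Re_mult_le) auto
    also have "\<dots> = (real k + 1) * (cmod (shift_up n s x k))\<^sup>2 + (cmod a)\<^sup>2 * ((real k + 1) * (cmod (shift_down m t x k))\<^sup>2)"
      by (simp add: norm_mult power_mult_distrib algebra_simps)
    finally show "norm (u k) \<le> (real k + 1) * (cmod (shift_up n s x k))\<^sup>2 + (cmod a)\<^sup>2 * ((real k + 1) * (cmod (shift_down m t x k))\<^sup>2)"
      unfolding u_def real_norm_def abs_mult[of "real k + 1"] by simp
  qed
  have "summable v" using u summable_iff_shift[of u n] unfolding uv by simp
  moreover have "u k = 0" if "k < n" for k using that by (simp add: u_def shift_up_def)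
  ultimately have "summable v" "suminf u = suminf v"
    using suminf_shift_zero(2)[of n u] unfolding uv by auto
  with u show "summable (\<lambda>i. c i * (2 * Re (x i * cnj (a * x (i + n + m)))))"
    and "summable (\<lambda>k. (real k + 1) * (2 * Re (shift_up n s x k * cnj (a * shift_down m t x k))))"
    and "(\<Sum>k. (real k + 1) * (2 * Re (shift_up n s x k * cnj (a * shift_down m t x k)))) =
         (\<Sum>i. c i * (2 * Re (x i * cnj (a * x (i + n + m)))))"
    unfolding u_def[abs_def] v_def[abs_def] by blast+
qed

lemma cmod_add_power2_Re: "(cmod (u + v))\<^sup>2 = (cmod u)\<^sup>2 + (cmod v)\<^sup>2 + 2 * Re (u * cnj v)"
  unfolding cmod_power2 by (simp add: power2_eq_square algebra_simps)

text \<open>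
  Expand both squares. The term of index \<open>k\<close> involves the coefficients \<open>x (k - n)\<close> and
  \<open>x (k + m)\<close> in the first sum and \<open>x (k + n)\<close> and \<open>x (k - m)\<close> in the second, so the mixed terms
  of both sums pair coefficients at distance \<open>n + m\<close>. The mixed terms of the second
  sum are those of the first with \<open>(n, s)\<close> and \<open>(m, t)\<close> exchanged.
\<close>

lemma commutator_form:
  assumes x: "bergman_seq x" and s: "s > 0" and t: "t > 0"
  shows "summable (\<lambda>i. (diagonal_weight n s i - (cmod a)\<^sup>2 * diagonal_weight m t i) * (cmod (x i))\<^sup>2)"
    and "summable (\<lambda>i. cross_weight n s m t i * (2 * Re (x i * cnj (a * x (i + n + m)))))"
    and "(\<Sum>k. (real k + 1) * (cmod (shift_up n s x k + a * shift_down m t x k))\<^sup>2) -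
         (\<Sum>k. (real k + 1) * (cmod (shift_down n s x k + cnj a * shift_up m t x k))\<^sup>2) =
         (\<Sum>i. (diagonal_weight n s i - (cmod a)\<^sup>2 * diagonal_weight m t i) * (cmod (x i))\<^sup>2) +
         (\<Sum>i. cross_weight n s m t i * (2 * Re (x i * cnj (a * x (i + n + m)))))"
proof -
  note upn = shift_up_sums[OF x s, of n] and upm = shift_up_sums[OF x t, of m]
  note don = shift_down_sums[OF x s, of n] and dom = shift_down_sums[OF x t, of m]
  note cr1 = shift_cross_sums[OF x s t, where n = n and m = m and a = a]
  have swap: "i + m + n = i + n + m" for i by simp
  note cr2 = shift_cross_sums[OF x t s, where n = m and m = n and a = a, unfolded swap]
  let ?U = "\<lambda>n s k. (real k + 1) * (cmod (shift_up n s x k))\<^sup>2"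
  let ?D = "\<lambda>n s k. (real k + 1) * (cmod (shift_down n s x k))\<^sup>2"
  let ?C = "\<lambda>n s m t k. (real k + 1) * (2 * Re (shift_up n s x k * cnj (a * shift_down m t x k)))"
  have e1: "(real k + 1) * (cmod (shift_up n s x k + a * shift_down m t x k))\<^sup>2 =
      ?U n s k + (cmod a)\<^sup>2 * ?D m t k + ?C n s m t k" for k
    unfolding cmod_add_power2_Re by (simp add: norm_mult power_mult_distrib algebra_simps)
  \<comment> \<open>The mixed term is rewritten so that the upward shift comes first, as in \<open>shift_cross_sums\<close>.\<close>
  have e2: "(real k + 1) * (cmod (shift_down n s x k + cnj a * shift_up m t x k))\<^sup>2 =
      ?D n s k + (cmod a)\<^sup>2 * ?U m t k + ?C m t n s k" for k
  proof -
    define r where "r = Re (shift_up m t x k * cnj (a * shift_down n s x k))"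
    have "Re (shift_down n s x k * cnj (cnj a * shift_up m t x k)) = r"
      by (simp add: r_def algebra_simps)
    then show ?thesis
      unfolding cmod_add_power2_Re r_def[symmetric]
      by (simp only:) (simp add: norm_mult power_mult_distrib distrib_left mult_ac)
  qed
  let ?u = "\<lambda>n s i. (real i + n + 1) / (real i + n + s + 1)\<^sup>2 * (cmod (x i))\<^sup>2"
  let ?d = "\<lambda>n s i. (if n \<le> i then (real i - n + 1) / (real i + s + 1)\<^sup>2 else 0) * (cmod (x i))\<^sup>2"
  let ?c = "\<lambda>n s m t i. (real i + real n + 1) / ((real i + real n + s + 1) * (real i + real n + real m + t + 1)) * (2 * Re (x i * cnj (a * x (i + n + m))))"
  let ?c' = "\<lambda>i. (real i + real m + 1) / ((real i + real m + t + 1) * (real i + real m + real n + s + 1)) * (2 * Re (x i * cnj (a * x (i + n + m))))"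
  have dg: "(diagonal_weight n s i - (cmod a)\<^sup>2 * diagonal_weight m t i) * (cmod (x i))\<^sup>2 =
      ?u n s i - ?d n s i - (cmod a)\<^sup>2 * (?u m t i - ?d m t i)" for i
    by (simp add: diagonal_weight_def algebra_simps)
  show "summable (\<lambda>i. (diagonal_weight n s i - (cmod a)\<^sup>2 * diagonal_weight m t i) * (cmod (x i))\<^sup>2)"
    unfolding dg by (intro summable_diff summable_mult upn upm don dom)
  have cg: "cross_weight n s m t i * (2 * Re (x i * cnj (a * x (i + n + m)))) = ?c n s m t i - ?c' i" for i
    by (simp add: cross_weight_def left_diff_distrib)
  show "summable (\<lambda>i. cross_weight n s m t i * (2 * Re (x i * cnj (a * x (i + n + m)))))"
    unfolding cg by (intro summable_diff cr1 cr2)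
  have "(\<Sum>k. (real k + 1) * (cmod (shift_up n s x k + a * shift_down m t x k))\<^sup>2) =
      (\<Sum>i. ?u n s i) + (cmod a)\<^sup>2 * (\<Sum>i. ?d m t i) + (\<Sum>i. ?c n s m t i)"
    unfolding e1 using upn dom cr1
    by (simp add: suminf_add[symmetric] suminf_mult summable_add summable_mult)
  moreover have "(\<Sum>k. (real k + 1) * (cmod (shift_down n s x k + cnj a * shift_up m t x k))\<^sup>2) =
      (\<Sum>i. ?d n s i) + (cmod a)\<^sup>2 * (\<Sum>i. ?u m t i) + (\<Sum>i. ?c' i)"
    unfolding e2 using upm don cr2
    by (simp add: suminf_add[symmetric] suminf_mult summable_add summable_mult)
  moreover have "(\<Sum>i. (diagonal_weight n s i - (cmod a)\<^sup>2 * diagonal_weight m t i) * (cmod (x i))\<^sup>2) =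
      (\<Sum>i. ?u n s i) - (\<Sum>i. ?d n s i) - (cmod a)\<^sup>2 * ((\<Sum>i. ?u m t i) - (\<Sum>i. ?d m t i))"
    unfolding dg using upn upm don dom
    by (simp add: suminf_diff[symmetric] suminf_mult summable_diff summable_mult)
  moreover have "(\<Sum>i. cross_weight n s m t i * (2 * Re (x i * cnj (a * x (i + n + m))))) = (\<Sum>i. ?c n s m t i) - (\<Sum>i. ?c' i)"
    unfolding cg using cr1 cr2 by (simp add: suminf_diff)
  ultimately show "(\<Sum>k. (real k + 1) * (cmod (shift_up n s x k + a * shift_down m t x k))\<^sup>2) -
         (\<Sum>k. (real k + 1) * (cmod (shift_down n s x k + cnj a * shift_up m t x k))\<^sup>2) =
         (\<Sum>i. (diagonal_weight n s i - (cmod a)\<^sup>2 * diagonal_weight m t i) * (cmod (x i))\<^sup>2) +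
         (\<Sum>i. cross_weight n s m t i * (2 * Re (x i * cnj (a * x (i + n + m)))))"
    by (simp add: algebra_simps)
qed

text \<open>
  Diagonal dominance: by the inequality \<open>2 |x| |y| \<le> |x|\<^sup>2 + |y|\<^sup>2\<close>, each \<open>|x i|\<^sup>2\<close> is charged
  for the mixed terms with its two neighbours at distance \<open>n + m\<close>.
\<close>

lemma commutator_form_nonneg:
  assumes x: "bergman_seq x" and s: "s > 0" and t: "t > 0"
    and dom: "\<And>i. cmod a * (\<bar>cross_weight n s m t i\<bar> + (if n + m \<le> i then \<bar>cross_weight n s m t (i - (n + m))\<bar> else 0))
                 \<le> diagonal_weight n s i - (cmod a)\<^sup>2 * diagonal_weight m t i"
  shows "0 \<le> (\<Sum>i. (diagonal_weight n s i - (cmod a)\<^sup>2 * diagonal_weight m t i) * (cmod (x i))\<^sup>2) +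
         (\<Sum>i. cross_weight n s m t i * (2 * Re (x i * cnj (a * x (i + n + m)))))"
proof -
  define d where "d i = diagonal_weight n s i - (cmod a)\<^sup>2 * diagonal_weight m t i" for i
  define e where "e i = cmod a * \<bar>cross_weight n s m t i\<bar>" for i
  define e' where "e' i = (if n + m \<le> i then e (i - (n + m)) else 0)" for i
  have e0: "0 \<le> e i" "0 \<le> e' i" for i by (auto simp: e_def e'_def)
  have de: "e i + e' i \<le> d i" for i
    using dom[of i] by (simp add: d_def e_def e'_def distrib_left split: if_splits)
  let ?X = "\<lambda>i. (cmod (x i))\<^sup>2"
  have sd: "summable (\<lambda>i. d i * ?X i)" unfolding d_def by (rule commutator_form(1)[OF x s t])
  have ed: "e i \<le> d i" "e' i \<le> d i" for i using de[of i] e0[of i] by linarith+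
  have se: "summable (\<lambda>i. e i * ?X i)"
  proof (rule summable_comparison_test'[where N = 0, OF sd])
    show "norm (e i * ?X i) \<le> d i * ?X i" for i
      using mult_right_mono[OF ed(1)[of i], of "?X i"] e0[of i] by simp
  qed
  have se': "summable (\<lambda>i. e' i * ?X i)"
  proof (rule summable_comparison_test'[where N = 0, OF sd])
    show "norm (e' i * ?X i) \<le> d i * ?X i" for i
      using mult_right_mono[OF ed(2)[of i], of "?X i"] e0[of i] by simp
  qed
  have shift: "e' (i + (n + m)) * ?X (i + (n + m)) = e i * ?X (i + n + m)" for i
    by (simp add: e'_def add.assoc)
  have ss: "summable (\<lambda>i. e i * ?X (i + n + m))"
    using se' summable_iff_shift[of "\<lambda>i. e' i * ?X i" "n + m"] by (simp only: shift)
  have "(\<Sum>i. e' i * ?X i) = (\<Sum>i. e i * ?X (i + n + m))"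
    using suminf_shift_zero(2)[of "n + m" "\<lambda>i. e' i * ?X i"] ss unfolding shift by (simp add: e'_def)
  moreover have "(\<Sum>i. e i * ?X i) + (\<Sum>i. e' i * ?X i) \<le> (\<Sum>i. d i * ?X i)"
    unfolding suminf_add[OF se se']
    by (rule suminf_le[OF _ summable_add[OF se se'] sd])
       (use mult_right_mono[OF de] in \<open>simp add: distrib_right\<close>)
  moreover have "(\<Sum>i. - (e i * ?X i + e i * ?X (i + n + m))) \<le> (\<Sum>i. cross_weight n s m t i * (2 * Re (x i * cnj (a * x (i + n + m)))))"
  proof (rule suminf_le)
    show "summable (\<lambda>i. - (e i * ?X i + e i * ?X (i + n + m)))"
      by (intro summable_minus summable_add se ss)
    show "summable (\<lambda>i. cross_weight n s m t i * (2 * Re (x i * cnj (a * x (i + n + m)))))"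
      by (rule commutator_form(2)[OF x s t])
    fix i
    have "\<bar>2 * Re (x i * cnj (a * x (i + n + m)))\<bar> \<le> cmod a * (?X i + ?X (i + n + m))"
    proof -
      have "\<bar>2 * Re (x i * cnj (a * x (i + n + m)))\<bar> \<le> 2 * (cmod (x i) * (cmod a * cmod (x (i + n + m))))"
        using abs_Re_le_cmod[of "x i * cnj (a * x (i + n + m))"] by (simp add: norm_mult)
      also have "\<dots> = cmod a * (2 * cmod (x i) * cmod (x (i + n + m)))" by simp
      also have "\<dots> \<le> cmod a * (?X i + ?X (i + n + m))"
        by (intro mult_left_mono sum_squares_bound) auto
      finally show ?thesis .
    qed
    then have "\<bar>cross_weight n s m t i * (2 * Re (x i * cnj (a * x (i + n + m))))\<bar> \<le> \<bar>cross_weight n s m t i\<bar> * (cmod a * (?X i + ?X (i + n + m)))"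
      unfolding abs_mult[of "cross_weight n s m t i"] by (rule mult_left_mono) simp
    also have "\<dots> = e i * ?X i + e i * ?X (i + n + m)"
      by (simp add: e_def algebra_simps)
    finally show "- (e i * ?X i + e i * ?X (i + n + m)) \<le> cross_weight n s m t i * (2 * Re (x i * cnj (a * x (i + n + m))))"
      by linarith
  qed
  ultimately show ?thesis
    using suminf_add[OF se ss] suminf_minus[OF summable_add[OF se ss]] by (simp add: d_def)
qed

section \<open>Asymptotics of the weights\<close>

text \<open>
  The two fractions agree to leading order; after the cancellation the weight is of order \<open>i\<^sup>-\<^sup>3\<close>,
  and it is visibly positive.
\<close>

lemma diagonal_weight_eq:
  fixes n i :: nat and s y :: real
  assumes "s > 0" "n \<le> i"
  defines "y \<equiv> real i + s + 1"
  shows "diagonal_weight n s i = (n * (n + 2 * s) * y + n\<^sup>2 * (n + s)) / (y\<^sup>2 * (y + n)\<^sup>2)"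
proof -
  have y: "y > 0" "y + n > 0" using assms by auto
  have "diagonal_weight n s i = (y + n - s) / (y + n)\<^sup>2 - (y - n - s) / y\<^sup>2"
    using assms by (simp add: diagonal_weight_def add_ac)
  also have "\<dots> = ((y + n - s) * y\<^sup>2 - (y - n - s) * (y + n)\<^sup>2) / (y\<^sup>2 * (y + n)\<^sup>2)"
    using y by (simp add: diff_frac_eq mult_ac)
  also have "(y + n - s) * y\<^sup>2 - (y - n - s) * (y + n)\<^sup>2 = n * (n + 2 * s) * y + n\<^sup>2 * (n + s)"
    by (simp add: algebra_simps power2_eq_square)
  finally show ?thesis .
qed

lemma diagonal_weight_pos:
  fixes n i :: nat and s :: real
  assumes "s > 0" "n \<ge> 1"
  shows "0 < diagonal_weight n s i"
proof (cases "n \<le> i")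
  case True
  then show ?thesis using assms
    by (subst diagonal_weight_eq) (auto intro!: divide_pos_pos add_pos_pos mult_pos_pos)
next
  case False
  then show ?thesis using assms by (auto simp: diagonal_weight_def intro!: divide_pos_pos)
qed

text \<open>
  Here too the leading terms of the numerators cancel, which leaves order \<open>i\<^sup>-\<^sup>3\<close> for fixed \<open>t\<close>.
\<close>

lemma cross_weight_eq:
  fixes n m i :: nat and s t y :: real
  assumes "s > 0" "t > 0"
  defines "y \<equiv> real i + 1"
  shows "cross_weight n s m t i = (t * (n * y + n\<^sup>2 + s * n - s * m) - m * s * (y + m)) /
      ((y + n + s) * (y + n + m + t) * (y + n + m + s) * (y + m + t))"
proof -
  have pos: "y + n + s > 0" "y + n + m + t > 0" "y + n + m + s > 0" "y + m + t > 0" using assms by auto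
  have "cross_weight n s m t i = (y + n) / ((y + n + s) * (y + n + m + t)) - (y + m) / ((y + m + t) * (y + n + m + s))"
    using assms by (simp add: cross_weight_def add_ac)
  also have "\<dots> = ((y + n) * ((y + m + t) * (y + n + m + s)) - (y + m) * ((y + n + s) * (y + n + m + t))) /
      (((y + n + s) * (y + n + m + t)) * ((y + m + t) * (y + n + m + s)))"
    using pos by (intro diff_frac_eq) auto
  also have "(y + n) * ((y + m + t) * (y + n + m + s)) - (y + m) * ((y + n + s) * (y + n + m + t)) =
      t * (n * y + n\<^sup>2 + s * n - s * m) - m * s * (y + m)"
    by (simp add: algebra_simps power2_eq_square)
  finally show ?thesis by (simp add: mult_ac)
qed

lemma diagonal_weight_lower:
  fixes n i :: nat and s :: real
  assumes "s > 0" "n \<le> i"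
  shows "n * (n + 2 * s) / (real i + s + 1 + n) ^ 3 \<le> diagonal_weight n s i"
proof -
  define y where "y = real i + s + 1"
  have y: "y > 0" using assms by (simp add: y_def)
  have "n * (n + 2 * s) / (y + n) ^ 3 \<le> n * (n + 2 * s) / (y * (y + n)\<^sup>2)"
  proof (rule divide_left_mono)
    show "y * (y + n)\<^sup>2 \<le> (y + n) ^ 3"
      unfolding power3_eq_cube power2_eq_square using y by (simp add: mult_right_mono)
  qed (use y assms in auto)
  also have "\<dots> = n * (n + 2 * s) * y / (y\<^sup>2 * (y + n)\<^sup>2)"
    using y by (simp add: power2_eq_square)
  also have "\<dots> \<le> (n * (n + 2 * s) * y + n\<^sup>2 * (n + s)) / (y\<^sup>2 * (y + n)\<^sup>2)"
    using y assms by (intro divide_right_mono) auto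
  also have "\<dots> = diagonal_weight n s i" using diagonal_weight_eq[OF assms] by (simp add: y_def)
  finally show ?thesis by (simp add: y_def)
qed

text \<open>
  Since \<open>diagonal_weight m t i\<close> is multiplied by \<open>|a|\<^sup>2\<close>, which is at most of order \<open>t\<^sup>-\<^sup>2\<close> below the
  threshold, a single factor \<open>t\<close> in this bound is harmless.
\<close>

lemma diagonal_weight_upper:
  fixes m i :: nat and t :: real
  assumes "t \<ge> 1" "m \<le> i"
  shows "diagonal_weight m t i \<le> t * (2 * m\<^sup>2 + 2 * m) / (real i + 1) ^ 3"
proof -
  define y where "y = real i + t + 1"
  define Y where "Y = real i + 1"
  have y: "Y > 0" "Y \<le> y" using assms by (auto simp: y_def Y_def)
  have "m * (m + 2 * t) * y + m\<^sup>2 * (m + t) \<le> m * (m + 2 * t) * (y + m) + m\<^sup>2 * (y + m)"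
  proof (rule add_mono)
    show "m\<^sup>2 * (m + t) \<le> m\<^sup>2 * (y + m)" using assms by (intro mult_left_mono) (auto simp: y_def)
    show "m * (m + 2 * t) * y \<le> m * (m + 2 * t) * (y + m)" using assms by (intro mult_left_mono) auto
  qed
  also have "\<dots> = (2 * m\<^sup>2 + t * (2 * m)) * (y + m)" by (simp add: algebra_simps power2_eq_square)
  also have "\<dots> \<le> (t * (2 * m\<^sup>2) + t * (2 * m)) * (y + m)"
    using y assms mult_right_mono[of 1 t "2 * (real m)\<^sup>2"] by (intro mult_right_mono add_mono) auto
  finally have "diagonal_weight m t i \<le> (t * (2 * m\<^sup>2 + 2 * m)) * (y + m) / (y\<^sup>2 * (y + m)\<^sup>2)"
    using diagonal_weight_eq[of t m i] assms y by (simp add: y_def[symmetric] divide_right_mono distrib_left)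
  also have "\<dots> = t * (2 * m\<^sup>2 + 2 * m) / (y\<^sup>2 * (y + m))"
    using y by (simp add: power2_eq_square)
  also have "\<dots> \<le> t * (2 * m\<^sup>2 + 2 * m) / Y ^ 3"
  proof (rule divide_left_mono)
    have "Y * Y * Y \<le> y * y * (y + m)" using y by (intro mult_mono) auto
    then show "Y ^ 3 \<le> y\<^sup>2 * (y + m)" by (simp add: power2_eq_square power3_eq_cube)
  qed (use y assms in \<open>auto intro!: mult_pos_pos add_pos_nonneg\<close>)
  finally show ?thesis by (simp add: Y_def)
qed

text \<open>
  The leading constant \<open>n\<close> is sharp, and it is the one that enters the threshold; the error terms are
  small when both \<open>i\<close> and \<open>t\<close> are large.
\<close>

lemma cross_weight_upper:
  fixes n m i :: nat and s t K :: real
  assumes s: "s > 0" and t: "t \<ge> 1"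
  defines "K \<equiv> (n\<^sup>2 + s * n + s * m) + m * s * (1 + m)"
  shows "\<bar>cross_weight n s m t i\<bar> \<le> t * (n + K / (real i + 1) + K / t) / (real i + 1) ^ 3"
proof -
  define y where "y = real i + 1"
  have y: "y \<ge> 1" by (simp add: y_def)
  define A where "A = n\<^sup>2 + s * n + s * m"
  define B where "B = m * s * (1 + m)"
  have AB: "0 \<le> A" "0 \<le> B" "K = A + B" using s by (auto simp: A_def B_def K_def)
  define num where "num = t * (n * y + n\<^sup>2 + s * n - s * m) - m * s * (y + m)"
  define den where "den = (y + n + s) * (y + n + m + t) * (y + n + m + s) * (y + m + t)"
  have "\<bar>num\<bar> \<le> t * (n * y + K) + K * y"
  proof -
    have "\<bar>t * (n * y + n\<^sup>2 + s * n - s * m)\<bar> = t * \<bar>n * y + n\<^sup>2 + s * n - s * m\<bar>"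
      using t by (simp add: abs_mult)
    also have "\<dots> \<le> t * (n * y + K)"
      using t s y AB by (intro mult_left_mono) (auto simp: A_def abs_le_iff)
    finally have 1: "\<bar>t * (n * y + n\<^sup>2 + s * n - s * m)\<bar> \<le> t * (n * y + K)" .
    have "y + m \<le> (1 + m) * y" using mult_left_mono[OF y, of m] by (simp add: algebra_simps)
    then have "m * s * (y + m) \<le> m * s * ((1 + m) * y)" using s by (intro mult_left_mono) auto
    also have "\<dots> = B * y" by (simp add: B_def)
    also have "\<dots> \<le> K * y" using AB y by (intro mult_right_mono) auto
    finally have "m * s * (y + m) \<le> K * y" .
    moreover have "0 \<le> m * s * (y + m)" using s y by simp
    ultimately show ?thesis using 1 unfolding num_def by linarith
  qed
  moreover have "y ^ 4 \<le> den"
  proof -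
    have "y * y * y * y \<le> den" unfolding den_def using y s t by (intro mult_mono) auto
    then show ?thesis by (simp add: power4_eq_xxxx)
  qed
  moreover have "0 < y ^ 4" using y by simp
  ultimately have "\<bar>num\<bar> / den \<le> (t * (n * y + K) + K * y) / y ^ 4"
    by (intro frac_le) auto
  also have "\<dots> = t * (n + K / y + K / t) / y ^ 3"
    using y t by (simp add: field_simps eval_nat_numeral)
  finally have "\<bar>num\<bar> / den \<le> t * (n + K / y + K / t) / y ^ 3" .
  moreover have "\<bar>cross_weight n s m t i\<bar> = \<bar>num\<bar> / den"
  proof -
    have "0 < den" using \<open>0 < y ^ 4\<close> \<open>y ^ 4 \<le> den\<close> by linarith
    then show ?thesis using cross_weight_eq[of s t n m i] s t
      by (simp add: num_def den_def y_def abs_divide)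
  qed
  ultimately show ?thesis by (simp add: y_def)
qed

lemma cross_weight_le_1:
  fixes n m i :: nat and s t :: real
  assumes "s > 0" "t > 0"
  shows "\<bar>cross_weight n s m t i\<bar> \<le> 1"
proof -
  have frac: "0 \<le> p / (q * r) \<and> p / (q * r) \<le> 1" if "0 < p" "p \<le> q" "1 \<le> r" for p q r :: real
    using that mult_mono[of p q 1 r] by (auto simp: divide_le_eq)
  have "0 \<le> (real i + n + 1) / ((real i + n + s + 1) * (real i + n + m + t + 1)) \<and>
        (real i + n + 1) / ((real i + n + s + 1) * (real i + n + m + t + 1)) \<le> 1"
    using assms by (intro frac) auto
  moreover have "0 \<le> (real i + m + 1) / ((real i + m + t + 1) * (real i + m + n + s + 1)) \<and>
        (real i + m + 1) / ((real i + m + t + 1) * (real i + m + n + s + 1)) \<le> 1"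
    using assms by (intro frac) auto
  ultimately show ?thesis unfolding cross_weight_def by linarith
qed

lemma diagonal_weight_le_1:
  fixes m i :: nat and t :: real
  assumes "t > 0"
  shows "diagonal_weight m t i \<le> 1"
proof -
  have "(real i + m + 1) * 1 \<le> (real i + m + t + 1) * (real i + m + t + 1)"
    using assms by (intro mult_mono) auto
  then have "(real i + m + 1) / (real i + m + t + 1)\<^sup>2 \<le> 1"
    using assms by (simp add: divide_le_eq power2_eq_square add_pos_nonneg)
  moreover have "0 \<le> (if m \<le> i then (real i - m + 1) / (real i + t + 1)\<^sup>2 else 0)" by simp
  ultimately show ?thesis unfolding diagonal_weight_def by linarith
qed

text \<open>
  Here \<open>\<alpha>\<close> stands for \<open>|a|\<close>. After multiplication by \<open>(i + 1)\<^sup>3\<close>, the left-hand side is at most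
  about \<open>2 c n\<close> and the right-hand side is about \<open>n (n + 2 s)\<close>. The bounds depend on \<open>t\<close> only through
  \<open>1/t \<le> \<delta>\<close>. So a \<open>\<delta>\<close> is fixed for which the limits as \<open>i \<rightarrow> \<infinity>\<close> are still in strict order,
  and then all large \<open>i\<close> are covered at once. For each smaller \<open>i\<close> the terms with \<open>\<alpha>\<close> tend to \<open>0\<close>
  as \<open>t \<rightarrow> \<infinity>\<close>.
\<close>

lemma diagonal_dominates_cross:
  fixes n m :: nat and s c :: real
  assumes s: "s > 0" and n: "n \<ge> 1" and c: "0 < c" "c < (real n + 2 * s) / 2"
  shows "\<forall>\<^sub>F t in at_top. \<forall>i \<alpha>. 0 \<le> \<alpha> \<longrightarrow> t * \<alpha> \<le> c \<longrightarrow>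
    \<alpha> * (\<bar>cross_weight n s m t i\<bar> + (if n + m \<le> i then \<bar>cross_weight n s m t (i - (n + m))\<bar> else 0))
      \<le> diagonal_weight n s i - \<alpha>\<^sup>2 * diagonal_weight m t i"
proof -
  define N where "N = n + m"
  define K where "K = (n\<^sup>2 + s * n + s * m) + m * s * (1 + m)"
  define M :: real where "M = 2 * m\<^sup>2 + 2 * m"
  define p where "p = n * (n + 2 * s)"
  have K0: "K \<ge> 0" and M0: "M \<ge> 0" using s by (auto simp: K_def M_def)
  define e where "e \<delta> = c * (n + K * \<delta>) + c * (n + K * \<delta>) + c\<^sup>2 * M * \<delta>" for \<delta>
  have "2 * c * n < (n + 2 * s) * n" using c n by (intro mult_strict_right_mono) auto
  then have lt: "e 0 < p" by (simp add: e_def p_def algebra_simps)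
  have "(e \<longlongrightarrow> e 0) (at_right 0)" unfolding e_def by (intro tendsto_intros)
  then have "\<forall>\<^sub>F \<delta> in at_right 0. e \<delta> < p"
    using lt by (rule order_tendstoD(2))
  moreover have "\<forall>\<^sub>F \<delta> in at_right (0::real). \<delta> > 0" by (rule eventually_at_right_less)
  ultimately have "\<forall>\<^sub>F \<delta> in at_right (0::real). e \<delta> < p \<and> \<delta> > 0" by (rule eventually_conj)
  then obtain \<delta> where \<delta>: "\<delta> > 0" "e \<delta> < p"
    using eventually_happens'[OF trivial_limit_at_right_real] by blast
  \<comment> \<open>With \<open>y = i + 1\<close>, this is \<open>y\<^sup>3\<close> times the difference between the bound for the terms with \<open>\<alpha>\<close> and the lower bound for \<open>diagonal_weight n s i\<close>.\<close>
  define G where "G y = c * (n + K / y + K * \<delta>) + (y / (y - N)) ^ 3 * (c * (n + K / (y - N) + K * \<delta>)) + c\<^sup>2 * M * \<delta>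
      - p * (y / (y + s + n)) ^ 3" for y :: real
  have lims: "((\<lambda>y::real. K / y) \<longlongrightarrow> 0) at_top" "((\<lambda>y::real. K / (y - N)) \<longlongrightarrow> 0) at_top"
    "((\<lambda>y::real. y / (y - N)) \<longlongrightarrow> 1) at_top" "((\<lambda>y::real. y / (y + s + n)) \<longlongrightarrow> 1) at_top"
    by real_asymp+
  have "(G \<longlongrightarrow> c * (real n + 0 + K * \<delta>) + 1 ^ 3 * (c * (real n + 0 + K * \<delta>)) + c\<^sup>2 * M * \<delta> - p * 1 ^ 3) at_top"
    unfolding G_def by (intro tendsto_intros lims)
  then have "\<forall>\<^sub>F y in at_top. G y < 0"
    by (rule order_tendstoD(2)) (use \<delta> in \<open>simp add: e_def\<close>)
  then obtain Y where Y: "\<And>y. y \<ge> Y \<Longrightarrow> G y < 0" by (auto simp: eventually_at_top_linorder)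
  define I where "I = max N (nat \<lceil>Y\<rceil>)"
  let ?L = "\<lambda>t i \<alpha>. \<alpha> * (\<bar>cross_weight n s m t i\<bar> + (if n + m \<le> i then \<bar>cross_weight n s m t (i - (n + m))\<bar> else 0))
      \<le> diagonal_weight n s i - \<alpha>\<^sup>2 * diagonal_weight m t i"
  have large: "?L t i \<alpha>" if t: "t \<ge> 1" "t \<ge> 1 / \<delta>" and i: "i \<ge> I" and \<alpha>: "0 \<le> \<alpha>" "t * \<alpha> \<le> c" for t i \<alpha>
  proof -
    define y where "y = real i + 1"
    have iN: "N \<le> i" "n \<le> i" "m \<le> i" using i by (auto simp: I_def N_def)
    have yN: "y - N \<ge> 1" using iN by (simp add: y_def)
    have y1: "y \<ge> 1" by (simp add: y_def)
    have "real i \<ge> Y" using i unfolding I_def by linarith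
    then have G: "G y < 0" by (intro Y) (simp add: y_def)
    have inv_t: "1 / t \<le> \<delta>" using t \<delta> by (simp add: field_simps)
    have cr: "\<alpha> * \<bar>cross_weight n s m t j\<bar> \<le> c * (n + K / (real j + 1) + K * \<delta>) / (real j + 1) ^ 3" for j
    proof -
      have "\<alpha> * \<bar>cross_weight n s m t j\<bar> \<le> \<alpha> * (t * (n + K / (real j + 1) + K / t) / (real j + 1) ^ 3)"
        using cross_weight_upper[OF s t(1), of n m j] \<alpha> unfolding K_def by (intro mult_left_mono) auto
      also have "\<dots> = (t * \<alpha>) * (n + K / (real j + 1) + K * (1 / t)) / (real j + 1) ^ 3"
        by simp
      also have "\<dots> \<le> c * (n + K / (real j + 1) + K * \<delta>) / (real j + 1) ^ 3"
        using \<alpha> K0 c inv_t t by (intro divide_right_mono mult_mono add_mono mult_left_mono add_nonneg_nonneg) auto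
      finally show ?thesis .
    qed
    have "\<alpha>\<^sup>2 * diagonal_weight m t i \<le> \<alpha>\<^sup>2 * (t * M / y ^ 3)"
      using diagonal_weight_upper[OF t(1) iN(3)] by (intro mult_left_mono) (auto simp: M_def y_def)
    also have "\<dots> = (t * \<alpha>)\<^sup>2 * (1 / t) * M / y ^ 3"
      using t by (simp add: power2_eq_square)
    also have "\<dots> \<le> c\<^sup>2 * \<delta> * M / y ^ 3"
      using \<alpha> t c M0 y1 inv_t
      by (intro divide_right_mono mult_right_mono mult_mono power_mono) auto
    finally have mu: "\<alpha>\<^sup>2 * diagonal_weight m t i \<le> c\<^sup>2 * M * \<delta> / y ^ 3" by (simp add: mult_ac)
    have lam: "p / (y + s + n) ^ 3 \<le> diagonal_weight n s i"
      using diagonal_weight_lower[OF s iN(2)] by (simp add: p_def y_def add_ac)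
    have c2: "\<alpha> * \<bar>cross_weight n s m t (i - N)\<bar> \<le> c * (n + K / (y - N) + K * \<delta>) / (y - N) ^ 3"
      using cr[of "i - N"] iN by (simp add: y_def of_nat_diff algebra_simps)
    have "y + s + n > 0" using y1 s by simp
    then have "G y / y ^ 3 = c * (n + K / y + K * \<delta>) / y ^ 3 + c * (n + K / (y - N) + K * \<delta>) / (y - N) ^ 3
        + c\<^sup>2 * M * \<delta> / y ^ 3 - p / (y + s + n) ^ 3"
      using y1 by (simp add: G_def add_divide_distrib diff_divide_distrib power_divide)
    moreover have "G y / y ^ 3 < 0" using G y1 by (simp add: divide_neg_pos)
    moreover have "\<alpha> * \<bar>cross_weight n s m t i\<bar> \<le> c * (n + K / y + K * \<delta>) / y ^ 3"
      using cr[of i] by (simp add: y_def)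
    ultimately have "\<alpha> * \<bar>cross_weight n s m t i\<bar> + \<alpha> * \<bar>cross_weight n s m t (i - N)\<bar> + \<alpha>\<^sup>2 * diagonal_weight m t i \<le> diagonal_weight n s i"
      using mu lam c2 by linarith
    then show ?thesis using iN by (simp add: N_def distrib_left)
  qed
  have small: "\<forall>\<^sub>F t in at_top. \<forall>\<alpha>. 0 \<le> \<alpha> \<longrightarrow> t * \<alpha> \<le> c \<longrightarrow> ?L t i \<alpha>" for i
  proof -
    have "((\<lambda>t::real. c / t) \<longlongrightarrow> 0) at_top" using c(1) by real_asymp
    then have "((\<lambda>t. 2 * (c / t) + (c / t)\<^sup>2) \<longlongrightarrow> 2 * 0 + 0\<^sup>2) at_top"
      by (intro tendsto_intros)
    then have "((\<lambda>t. 2 * (c / t) + (c / t)\<^sup>2) \<longlongrightarrow> 0) at_top" by simp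
    then have "\<forall>\<^sub>F t in at_top. 2 * (c / t) + (c / t)\<^sup>2 < diagonal_weight n s i"
      by (rule order_tendstoD(2)) (rule diagonal_weight_pos[OF s n])
    then show ?thesis using eventually_gt_at_top[of 0]
    proof eventually_elim
      case (elim t)
      show ?case
      proof (intro allI impI)
        fix \<alpha> assume \<alpha>: "0 \<le> \<alpha>" "t * \<alpha> \<le> c"
        then have le: "\<alpha> \<le> c / t" using elim by (simp add: field_simps)
        define E where "E = \<bar>cross_weight n s m t i\<bar> + (if n + m \<le> i then \<bar>cross_weight n s m t (i - (n + m))\<bar> else 0)"
        have "E \<ge> 0" "E \<le> 2"
          using cross_weight_le_1[OF s elim(2), of n m i] cross_weight_le_1[OF s elim(2), of n m "i - (n + m)"]
          by (auto simp: E_def)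
        then have "\<alpha> * E \<le> (c / t) * 2"
          using le \<alpha> by (intro mult_mono) auto
        moreover have "\<alpha>\<^sup>2 * diagonal_weight m t i \<le> \<alpha>\<^sup>2 * 1"
          by (intro mult_left_mono diagonal_weight_le_1 elim) auto
        moreover have "\<alpha>\<^sup>2 \<le> (c / t)\<^sup>2" using le \<alpha> by (intro power_mono)
        moreover have "A \<le> L - B" if "A \<le> q * 2" "B \<le> D * 1" "D \<le> q\<^sup>2" "2 * q + q\<^sup>2 < L" for A B D L q :: real
          using that by linarith
        ultimately have "\<alpha> * E \<le> diagonal_weight n s i - \<alpha>\<^sup>2 * diagonal_weight m t i" using elim(1) by blast
        then show "?L t i \<alpha>" by (simp only: E_def)
      qed
    qed
  qed
  have "\<forall>\<^sub>F t in at_top. \<forall>i\<in>{..<I}. \<forall>\<alpha>. 0 \<le> \<alpha> \<longrightarrow> t * \<alpha> \<le> c \<longrightarrow> ?L t i \<alpha>"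
    by (intro eventually_ball_finite ballI small) auto
  then show ?thesis using eventually_ge_at_top[of 1] eventually_ge_at_top[of "1 / \<delta>"]
    by eventually_elim (use large in \<open>meson lessThan_iff not_le\<close>)
qed

lemma diagonal_weight_asymp:
  fixes n d :: nat and s :: real
  assumes s: "s > 0" and n: "n \<ge> 1"
  shows "(\<lambda>k. real k ^ 3 * diagonal_weight n s (k + d)) \<longlonglongrightarrow> n * (n + 2 * s)"
proof (rule Lim_transform_eventually)
  define b where "b = n * (n + 2 * s)"
  have "b > 0" using assms by (simp add: b_def)
  then show "(\<lambda>k. real k ^ 3 * ((b * (real k + d + s + 1) + n\<^sup>2 * (n + s)) / ((real k + d + s + 1)\<^sup>2 * (real k + d + s + 1 + n)\<^sup>2)))
      \<longlonglongrightarrow> b"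
    by real_asymp
  show "\<forall>\<^sub>F k in sequentially. real k ^ 3 * ((b * (real k + d + s + 1) + n\<^sup>2 * (n + s)) / ((real k + d + s + 1)\<^sup>2 * (real k + d + s + 1 + n)\<^sup>2))
      = real k ^ 3 * diagonal_weight n s (k + d)"
    using eventually_ge_at_top[of n] by eventually_elim (simp add: diagonal_weight_eq s b_def)
qed

lemma cross_weight_asymp:
  fixes n m d :: nat and s t :: real
  assumes s: "s > 0" and t: "t > 0" and pos: "n * t - m * s > 0"
  shows "(\<lambda>k. real k ^ 3 * cross_weight n s m t (k + d)) \<longlonglongrightarrow> n * t - m * s"
proof -
  define b where "b = n * t - m * s"
  define e where "e = t * (n\<^sup>2 + s * n - s * m) - m * s * m"
  have b: "b > 0" using pos by (simp add: b_def)
  have num: "t * (n * y + n\<^sup>2 + s * n - s * m) - m * s * (y + m) = b * y + e" for y :: real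
    by (simp add: b_def e_def algebra_simps)
  have "(\<lambda>k. real k ^ 3 * ((b * (real k + d + 1) + e) /
      ((real k + d + 1 + n + s) * (real k + d + 1 + n + m + t) * (real k + d + 1 + n + m + s) * (real k + d + 1 + m + t)))) \<longlonglongrightarrow> b"
    using b by real_asymp
  then show ?thesis
    unfolding cross_weight_eq[OF s t] num by (simp add: b_def)
qed

section \<open>The threshold for hyponormality\<close>

text \<open>
  The test sequence has \<open>P + 1\<close> coefficients of modulus \<open>1\<close> at \<open>k, k + N, \<dots>, k + P N\<close>, with phases
  that give every mixed term its most negative value. Multiplied by \<open>k\<^sup>3\<close>, the form is bounded above by
  a quantity that tends to \<open>(P + 1) n (n + 2 s) - 2 |a| P (n t - m s)\<close> as \<open>k \<rightarrow> \<infinity>\<close>, and this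
  limit is negative for large \<open>P\<close> by the hypothesis on \<open>a\<close>.
\<close>

lemma commutator_form_negative:
  fixes n m :: nat and s t :: real and a :: complex
  assumes s: "s > 0" and t: "t > 0" and n: "n \<ge> 1" and m: "m \<ge> 1" and a: "a \<noteq> 0"
    and lt: "n * (n + 2 * s) < 2 * cmod a * (n * t - m * s)"
  obtains x where "bergman_seq x"
    "(\<Sum>i. (diagonal_weight n s i - (cmod a)\<^sup>2 * diagonal_weight m t i) * (cmod (x i))\<^sup>2) +
     (\<Sum>i. cross_weight n s m t i * (2 * Re (x i * cnj (a * x (i + n + m))))) < 0"
proof -
  define N where "N = n + m"
  have N: "N > 0" using n by (simp add: N_def)
  define p where "p = n * (n + 2 * s)"
  define b where "b = n * t - m * s"
  have p: "p > 0" using s n by (simp add: p_def)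
  then have "0 < 2 * cmod a * b" using lt by (simp add: p_def b_def)
  then have b: "b > 0" using a by (simp add: zero_less_mult_iff)
  obtain P :: nat where "p / (2 * cmod a * b - p) < P" using reals_Archimedean2 by blast
  then have P: "(real P + 1) * p - 2 * cmod a * (P * b) < 0"
    using lt unfolding p_def[symmetric] b_def[symmetric] by (simp add: field_simps)
  define g where "g k = (\<Sum>j\<le>P. diagonal_weight n s (k + j * N)) - 2 * cmod a * (\<Sum>j<P. cross_weight n s m t (k + j * N))" for k
  have "(\<lambda>k. (\<Sum>j\<le>P. real k ^ 3 * diagonal_weight n s (k + j * N)) - 2 * cmod a * (\<Sum>j<P. real k ^ 3 * cross_weight n s m t (k + j * N)))
      \<longlonglongrightarrow> (\<Sum>j\<le>P. p) - 2 * cmod a * (\<Sum>j<P. b)"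
    unfolding p_def b_def using b
    by (intro tendsto_intros diagonal_weight_asymp cross_weight_asymp s n t) (simp add: b_def)
  then have "(\<lambda>k. real k ^ 3 * g k) \<longlonglongrightarrow> (real P + 1) * p - 2 * cmod a * (P * b)"
    by (simp add: g_def right_diff_distrib sum_distrib_left mult.left_commute add.commute)
  then have "\<forall>\<^sub>F k in sequentially. real k ^ 3 * g k < 0"
    using P by (rule order_tendstoD(2))
  then obtain k where "real k ^ 3 * g k < 0" by (auto simp: eventually_sequentially)
  then have gk: "g k < 0" by (simp add: mult_less_0_iff)
  \<comment> \<open>The ratio of consecutive coefficients; it makes \<open>a * u\<close> negative.\<close>
  define u where "u = - cnj a / cmod a"
  have u1: "cmod u = 1" using a by (simp add: u_def norm_divide)
  have au: "a * u = - cmod a"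
    using a by (simp add: u_def complex_norm_square[symmetric] power2_eq_square)
  define J where "J j = k + j * N" for j
  have inj: "inj_on J A" for A using N by (auto simp: J_def inj_on_def)
  define x where "x i = (if i \<in> J ` {..P} then u ^ ((i - k) div N) else 0)" for i
  have xJ: "x (J j) = (if j \<le> P then u ^ j else 0)" for j
    using N by (auto simp: x_def J_def)
  have x0: "x i = 0" if "i \<notin> J ` {..P}" for i using that by (simp add: x_def)
  have bs: "bergman_seq x"
    by (rule summable_finite[of "J ` {..P}"]) (auto simp: x0)
  have "(\<Sum>i. (diagonal_weight n s i - (cmod a)\<^sup>2 * diagonal_weight m t i) * (cmod (x i))\<^sup>2)
      = (\<Sum>i\<in>J ` {..P}. (diagonal_weight n s i - (cmod a)\<^sup>2 * diagonal_weight m t i) * (cmod (x i))\<^sup>2)"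
    by (rule suminf_finite) (auto simp: x0)
  also have "\<dots> = (\<Sum>j\<le>P. diagonal_weight n s (J j) - (cmod a)\<^sup>2 * diagonal_weight m t (J j))"
    using u1 by (subst sum.reindex[OF inj]) (auto simp: xJ norm_power intro!: sum.cong)
  also have "\<dots> \<le> (\<Sum>j\<le>P. diagonal_weight n s (J j))"
    using diagonal_weight_pos[OF t m] by (intro sum_mono) (simp add: less_imp_le)
  finally have 1: "(\<Sum>i. (diagonal_weight n s i - (cmod a)\<^sup>2 * diagonal_weight m t i) * (cmod (x i))\<^sup>2) \<le> (\<Sum>j\<le>P. diagonal_weight n s (J j))" .
  have JS: "J j + n + m = J (Suc j)" for j by (simp add: J_def N_def)
  have term0: "x i * cnj (a * x (i + n + m)) = 0" if "i \<notin> J ` {..<P}" for i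
  proof (cases "i \<in> J ` {..P}")
    case True
    then obtain j where j: "i = J j" "j \<le> P" by auto
    then have "j = P" using that by (metis image_eqI lessThan_iff le_neq_implies_less)
    then show ?thesis using j JS[of j] by (simp add: xJ)
  qed (simp add: x0)
  have termJ: "x (J j) * cnj (a * x (J j + n + m)) = - cmod a" if "j < P" for j
  proof -
    have "x (J j) * cnj (a * x (J j + n + m)) = (u * cnj u) ^ j * cnj (a * u)"
      using that by (simp add: JS xJ power_mult_distrib mult_ac)
    then show ?thesis using u1 by (simp add: au complex_norm_square[symmetric])
  qed
  have "(\<Sum>i. cross_weight n s m t i * (2 * Re (x i * cnj (a * x (i + n + m)))))
      = (\<Sum>i\<in>J ` {..<P}. cross_weight n s m t i * (2 * Re (x i * cnj (a * x (i + n + m)))))"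
  proof (rule suminf_finite)
    show "cross_weight n s m t i * (2 * Re (x i * cnj (a * x (i + n + m)))) = 0" if "i \<notin> J ` {..<P}" for i
      unfolding term0[OF that] by simp
  qed simp
  also have "\<dots> = (\<Sum>j<P. cross_weight n s m t (J j) * (2 * - cmod a))"
    unfolding sum.reindex[OF inj] o_def by (intro sum.cong refl) (simp only: termJ lessThan_iff Re_complex_of_real uminus_complex.sel)
  also have "\<dots> = - 2 * cmod a * (\<Sum>j<P. cross_weight n s m t (J j))"
    by (simp add: sum_distrib_left sum_negf mult_ac)
  finally have 2: "(\<Sum>i. cross_weight n s m t i * (2 * Re (x i * cnj (a * x (i + n + m))))) = - 2 * cmod a * (\<Sum>j<P. cross_weight n s m t (J j))" .
  from 1 2 gk have "(\<Sum>i. (diagonal_weight n s i - (cmod a)\<^sup>2 * diagonal_weight m t i) * (cmod (x i))\<^sup>2) +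
     (\<Sum>i. cross_weight n s m t i * (2 * Re (x i * cnj (a * x (i + n + m))))) < 0"
    unfolding g_def J_def by linarith
  with bs that show ?thesis by blast
qed

lemma hyponormal_iff_commutator_form:
  fixes n m :: nat and s t :: real and a :: complex
  assumes s: "s > 0" and t: "t > 0"
    and \<phi>: "\<And>z. \<phi> z = z ^ n * of_real (cmod z powr (2 * s)) + a * cnj z ^ m * of_real (cmod z powr (2 * t))"
  shows "hyponormal (toeplitz \<phi>) \<longleftrightarrow> (\<forall>x. bergman_seq x \<longrightarrow>
    0 \<le> (\<Sum>i. (diagonal_weight n s i - (cmod a)\<^sup>2 * diagonal_weight m t i) * (cmod (x i))\<^sup>2) +
        (\<Sum>i. cross_weight n s m t i * (2 * Re (x i * cnj (a * x (i + n + m))))))"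
    (is "_ \<longleftrightarrow> (\<forall>x. _ \<longrightarrow> 0 \<le> ?F x)")
proof -
  define u where "u n s z = z ^ n * of_real (cmod z powr (2 * s))" for n s and z :: complex
  define d where "d n s z = cnj z ^ n * of_real (cmod z powr (2 * s))" for n s and z :: complex
  have \<phi>_eq: "\<phi> z = u n s z + a * d m t z" for z by (simp add: \<phi> u_def d_def)
  have [measurable]: "u k r \<in> borel_measurable disk_area" "d k r \<in> borel_measurable disk_area" for k r
    unfolding u_def d_def by measurable
  have bd: "cmod (u k r z) \<le> 1" "cmod (d k r z) \<le> 1" if "r > 0" "cmod z < 1" for k r z
    using that by (auto simp: u_def d_def norm_mult norm_power power_le_one powr_le1 mult_le_one)
  have sym: "bounded_symbol \<phi>"
    unfolding bounded_symbol_def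
  proof (intro conjI exI allI impI)
    show "\<phi> \<in> borel_measurable disk_area" unfolding \<phi>_eq[abs_def] by measurable
    fix z :: complex assume "cmod z < 1"
    then have "cmod (u n s z) \<le> 1" "cmod (a * d m t z) \<le> cmod a * 1"
      using bd s t by (auto simp: norm_mult intro!: mult_left_le)
    then show "cmod (\<phi> z) \<le> 1 + cmod a * 1"
      unfolding \<phi>_eq by (rule norm_triangle_mono)
  qed
  have sq: "square_integrable (\<lambda>z. u k r z * f z)" "square_integrable (\<lambda>z. c * (d k r z * f z))"
     "square_integrable (\<lambda>z. d k r z * f z)" "square_integrable (\<lambda>z. c * (u k r z * f z))"
    if "f \<in> bergman_space" "r > 0" for f k r c
    using square_integrable_bounded_mult(1)[OF bergman_spaceD(3)[OF that(1)], of "u k r" 1]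
      square_integrable_bounded_mult(1)[OF bergman_spaceD(3)[OF that(1)], of "d k r" 1] bd[OF that(2)]
    by (auto intro: square_integrable_mult_const)
  have cu: "bergman_coeff (\<lambda>z. u k r z * f z) j = (of_nat j + 1) * shift_up k r (bergman_coeff f) j"
    if "f \<in> bergman_space" "r > 0" for f k r j
    using bergman_coeff_raise[OF that] by (simp add: u_def shift_up_def)
  have cd: "bergman_coeff (\<lambda>z. d k r z * f z) j = (of_nat j + 1) * shift_down k r (bergman_coeff f) j"
    if "f \<in> bergman_space" "r > 0" for f k r j
    using bergman_coeff_lower[OF that] by (simp add: d_def shift_down_def)
  have norm_eq: "(cmod ((of_nat j + 1) * w))\<^sup>2 / (real j + 1) = (real j + 1) * (cmod w)\<^sup>2" for j w
  proof -
    have "cmod (of_nat j + 1) = real j + 1" by (metis of_nat_Suc norm_of_nat add.commute)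
    then show ?thesis by (simp add: norm_mult power_mult_distrib power2_eq_square)
  qed
  have c1: "bergman_coeff (\<lambda>z. \<phi> z * f z) j = (of_nat j + 1) * (shift_up n s (bergman_coeff f) j + a * shift_down m t (bergman_coeff f) j)"
    if f: "f \<in> bergman_space" for f j
  proof -
    have "(\<lambda>z. \<phi> z * f z) = (\<lambda>z. u n s z * f z + a * (d m t z * f z))"
      by (simp add: \<phi>_eq fun_eq_iff algebra_simps)
    then have "bergman_coeff (\<lambda>z. \<phi> z * f z) j = (of_nat j + 1) * shift_up n s (bergman_coeff f) j + a * ((of_nat j + 1) * shift_down m t (bergman_coeff f) j)"
      using f s t by (simp add: bergman_coeff_add bergman_coeff_mult_const sq cu cd)
    then show ?thesis by (simp add: algebra_simps)
  qed
  have c2: "bergman_coeff (\<lambda>z. cnj (\<phi> z) * f z) j = (of_nat j + 1) * (shift_down n s (bergman_coeff f) j + cnj a * shift_up m t (bergman_coeff f) j)"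
    if f: "f \<in> bergman_space" for f j
  proof -
    have "(\<lambda>z. cnj (\<phi> z) * f z) = (\<lambda>z. d n s z * f z + cnj a * (u m t z * f z))"
      by (simp add: \<phi> u_def d_def fun_eq_iff algebra_simps)
    then have "bergman_coeff (\<lambda>z. cnj (\<phi> z) * f z) j = (of_nat j + 1) * shift_down n s (bergman_coeff f) j + cnj a * ((of_nat j + 1) * shift_up m t (bergman_coeff f) j)"
      using f s t by (simp add: bergman_coeff_add bergman_coeff_mult_const sq cu cd)
    then show ?thesis by (simp add: algebra_simps)
  qed
  have "hyponormal (toeplitz \<phi>) \<longleftrightarrow> (\<forall>f\<in>bergman_space. 0 \<le> ?F (bergman_coeff f))"
    unfolding hyponormal_toeplitz_iff[OF sym]
  proof (rule ball_cong[OF refl])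
    fix f assume f: "f \<in> bergman_space"
    have "bergman_seq (bergman_coeff f)" by (intro Bessel_inequality bergman_spaceD f)
    from commutator_form(3)[OF this s t, where n = n and m = m and a = a]
    show "((\<Sum>k. (cmod (bergman_coeff (\<lambda>z. cnj (\<phi> z) * f z) k))\<^sup>2 / (real k + 1)) \<le>
           (\<Sum>k. (cmod (bergman_coeff (\<lambda>z. \<phi> z * f z) k))\<^sup>2 / (real k + 1))) \<longleftrightarrow> 0 \<le> ?F (bergman_coeff f)"
      unfolding c1[OF f] c2[OF f] norm_eq by linarith
  qed
  also have "\<dots> \<longleftrightarrow> (\<forall>x. bergman_seq x \<longrightarrow> 0 \<le> ?F x)"
  proof (intro iffI allI impI ballI)
    fix x assume "\<forall>f\<in>bergman_space. 0 \<le> ?F (bergman_coeff f)" "bergman_seq x"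
    then have "0 \<le> ?F (bergman_coeff (bergman_series x))"
      using bergman_series_in_space(1) by blast
    then show "0 \<le> ?F x"
      unfolding bergman_series_in_space(2)[OF \<open>bergman_seq x\<close>] .
  next
    fix f assume "\<forall>x. bergman_seq x \<longrightarrow> 0 \<le> ?F x" "f \<in> bergman_space"
    then show "0 \<le> ?F (bergman_coeff f)"
      using Bessel_inequality(1)[OF bergman_spaceD(3)] by blast
  qed
  finally show ?thesis .
qed

theorem theorem1p4:
  fixes s :: real and m n :: nat and a :: "real \<Rightarrow> complex"
    and \<phi> :: "real \<Rightarrow> complex \<Rightarrow> complex"
  assumes "s > 0" and "m \<ge> 1" and "n \<ge> 1"
    and "\<And>t z. t > 0 \<Longrightarrow> \<phi> t z = z ^ n * of_real (cmod z powr (2 * s))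
                              + a t * cnj z ^ m * of_real (cmod z powr (2 * t))"
  shows "(Limsup at_top (\<lambda>t. ereal (cmod (of_real t * a t))) < ereal ((real n + 2 * s) / 2) \<longrightarrow>
            (\<forall>\<^sub>F t in at_top. hyponormal (toeplitz (\<phi> t)))) \<and>
         (Liminf at_top (\<lambda>t. ereal (cmod (of_real t * a t))) > ereal ((real n + 2 * s) / 2) \<longrightarrow>
            (\<forall>\<^sub>F t in at_top. \<not> hyponormal (toeplitz (\<phi> t))))"
proof (intro conjI impI)
  define C where "C = (real n + 2 * s) / 2"
  have C: "C > 0" using assms by (simp add: C_def)
  have iff: "hyponormal (toeplitz (\<phi> t)) \<longleftrightarrow> (\<forall>x. bergman_seq x \<longrightarrow>
    0 \<le> (\<Sum>i. (diagonal_weight n s i - (cmod (a t))\<^sup>2 * diagonal_weight m t i) * (cmod (x i))\<^sup>2) +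
        (\<Sum>i. cross_weight n s m t i * (2 * Re (x i * cnj (a t * x (i + n + m))))))" if "t > 0" for t
    by (rule hyponormal_iff_commutator_form[OF assms(1) that assms(4)[OF that]])
  {
    assume "Limsup at_top (\<lambda>t. ereal (cmod (of_real t * a t))) < ereal ((real n + 2 * s) / 2)"
    then have "max (ereal 0) (Limsup at_top (\<lambda>t. ereal (cmod (of_real t * a t)))) < ereal C"
      using C by (simp add: C_def)
    then obtain c where c: "max (ereal 0) (Limsup at_top (\<lambda>t. ereal (cmod (of_real t * a t)))) < ereal c" "ereal c < ereal C"
      using ereal_dense2 by blast
    then have "\<forall>\<^sub>F t in at_top. ereal (cmod (of_real t * a t)) < ereal c"
      by (intro Limsup_lessD) simp
    moreover have "0 < c" "c < C" using c by auto
    then have "\<forall>\<^sub>F t in at_top. \<forall>i \<alpha>. 0 \<le> \<alpha> \<longrightarrow> t * \<alpha> \<le> c \<longrightarrow>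
      \<alpha> * (\<bar>cross_weight n s m t i\<bar> + (if n + m \<le> i then \<bar>cross_weight n s m t (i - (n + m))\<bar> else 0))
        \<le> diagonal_weight n s i - \<alpha>\<^sup>2 * diagonal_weight m t i"
      unfolding C_def by (intro diagonal_dominates_cross assms)
    ultimately show "\<forall>\<^sub>F t in at_top. hyponormal (toeplitz (\<phi> t))"
      using eventually_gt_at_top[of 0]
    proof eventually_elim
      case (elim t)
      have "t * cmod (a t) \<le> c" using elim(1,3) by (simp add: norm_mult)
      then show ?case
        unfolding iff[OF elim(3)] using elim(2)
        by (intro allI impI commutator_form_nonneg assms elim) auto
    qed
  }
  {
    assume "Liminf at_top (\<lambda>t. ereal (cmod (of_real t * a t))) > ereal ((real n + 2 * s) / 2)"
    then have "ereal C < Liminf at_top (\<lambda>t. ereal (cmod (of_real t * a t)))" by (simp add: C_def)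
    then obtain c where c: "ereal C < ereal c" "ereal c < Liminf at_top (\<lambda>t. ereal (cmod (of_real t * a t)))"
      using ereal_dense2 by blast
    have "\<forall>\<^sub>F t in at_top. ereal c < ereal (cmod (of_real t * a t))"
      using c(2) by (rule less_LiminfD)
    moreover have "((\<lambda>t::real. m * s / t) \<longlongrightarrow> 0) at_top"
      by real_asymp
    then have "((\<lambda>t. 2 * c * (n - m * s / t)) \<longlongrightarrow> 2 * c * (real n - 0)) at_top"
      by (intro tendsto_intros)
    then have "\<forall>\<^sub>F t in at_top. n * (n + 2 * s) < 2 * c * (n - m * s / t)"
    proof (rule order_tendstoD(1))
      \<comment> \<open>The threshold for \<open>|t a|\<close> is exactly where twice the limiting off-diagonal weight meets the diagonal one.\<close>
      have "n * (n + 2 * s) = 2 * C * n" by (simp add: C_def)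
      then show "n * (n + 2 * s) < 2 * c * (real n - 0)" using c(1) assms by simp
    qed
    ultimately show "\<forall>\<^sub>F t in at_top. \<not> hyponormal (toeplitz (\<phi> t))"
      using eventually_gt_at_top[of 0]
    proof eventually_elim
      case (elim t)
      have ca: "c < t * cmod (a t)" and c0: "0 < c" using elim(1,3) c(1) C by (auto simp: norm_mult)
      then have a0: "a t \<noteq> 0" by auto
      have "0 < n * (n + 2 * s)" using assms by simp
      then have "0 < n - m * s / t" using elim(2) c0 by (metis less_trans mult_pos_pos zero_less_mult_pos zero_less_numeral)
      then have "2 * c * (n - m * s / t) \<le> 2 * (t * cmod (a t)) * (n - m * s / t)"
        using ca by (intro mult_right_mono) auto
      also have "\<dots> = 2 * cmod (a t) * (n * t - m * s)" using elim(3) by (simp add: field_simps)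
      finally have "n * (n + 2 * s) < 2 * cmod (a t) * (n * t - m * s)" using elim(2) by linarith
      from commutator_form_negative[OF assms(1) elim(3) assms(3,2) a0 this]
      obtain x where x: "bergman_seq x"
        "(\<Sum>i. (diagonal_weight n s i - (cmod (a t))\<^sup>2 * diagonal_weight m t i) * (cmod (x i))\<^sup>2) +
         (\<Sum>i. cross_weight n s m t i * (2 * Re (x i * cnj (a t * x (i + n + m))))) < 0" .
      show ?case
      proof
        assume "hyponormal (toeplitz (\<phi> t))"
        with x(1) have "0 \<le> (\<Sum>i. (diagonal_weight n s i - (cmod (a t))\<^sup>2 * diagonal_weight m t i) * (cmod (x i))\<^sup>2) +
         (\<Sum>i. cross_weight n s m t i * (2 * Re (x i * cnj (a t * x (i + n + m)))))"
          unfolding iff[OF elim(3)] by blast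
        with x(2) show False by linarith
      qed
    qed
  }
qed

end
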